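(* Assume that $\mathbb{E} |X_1| < \infty$ and $\mathbb{E} X_1 \neq 0$, and let $\alpha$ be irrational such that $\inf_{h \in \mathbb{Z}\backslash \{ 0 \}} |h|^{\gamma} \| h \alpha \| >0$ with some constant $1 \le \gamma <2$. Then for any $f \in \mathcal{F}$, \[ C(p/q, f) \to C(\alpha, f) \] as $p/q \to \alpha$ along the sequence of best rational approximations to $\alpha$, provided that $D= \gcd (\mathrm{supp}\, X_1 - \mathrm{supp}\, X_1)$ is relatively prime to all but finitely many $q$ in this sequence.
   Context: $X_1, X_2, \dots$ are i.i.d. nondegenerate (not a.s. constant) integer-valued random variables and $S_k=\sum_{j=1}^k X_j$. $\mathrm{supp}\,X_1=\{n\in\mathbb{Z}:\Pr(X_1=n)>0\}$; for $A\subseteq\mathbb{Z}$, $A-A=\{a-b:a,b\in A\}$ and $\gcd(A)$ is the positive greatest common divisor of the elements of $A$. $\|x\|$ denotes the distance from $x$ to the nearest integer. $\mathcal{F}$ is the set of all $1$-periodic functions $f:\mathbb{R}\to\mathbb{R}$ that are of bounded variation on $[0,1]$. Irrational case: with $\bar f=f-\int_0^1 f(x)\,\mathrm{d}x$ and $U$ uniformly distributed on $\mathbb{R}/\mathbb{Z}$ (identified with $[0,1)$), independent of $X_1,X_2,\dots$, \[ C(\alpha, f) = \mathbb{E} \bar{f}(U)^2 + 2 \sum_{k=1}^{\infty} \mathbb{E} \bar{f}(U) \bar{f}(U+S_k\alpha ), \] a convergent series under the hypotheses of the claim. Rational case: for a reduced fraction $p/q$ with $\gcd(D,q)=1$, let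 $\bar f=f-q^{-1}\sum_{a=0}^{q-1}f(a/q)$, let $U$ be uniformly distributed on $\mathbb{Z}_q=\{0,1/q,\dots,(q-1)/q\}$, independent of $X_1,X_2,\dots$, and \[ C(p/q, f) = \mathbb{E} \bar{f}(U)^2 + 2 \sum_{k=1}^{\infty} \mathbb{E} \bar{f}(U) \bar{f}(U+S_kp/q), \] a convergent series. The best rational approximations to $\alpha$ are the reduced fractions $p/q$, $q\ge 1$, with $|q\alpha-p|=\|q\alpha\|$ and $\|h\alpha\|\ge\|q\alpha\|$ for all integers $0<h<q$; they form an infinite sequence with $q\to\infty$. *)

theory Defs
  imports "HOL-Probability.Probability"
begin

definition int_dist :: "real \<Rightarrow> real" where
  "int_dist x = \<bar>x - of_int (round x)\<bar>"

definition bounded_var_on :: "real \<Rightarrow> real \<Rightarrow> (real \<Rightarrow> real) \<Rightarrow> bool" where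
  "bounded_var_on a b f \<longleftrightarrow>
     (\<exists>B. \<forall>n. \<forall>x :: nat \<Rightarrow> real. mono_on {..n} x \<and> x ` {..n} \<subseteq> {a..b} \<longrightarrow>
        (\<Sum>i<n. \<bar>f (x (Suc i)) - f (x i)\<bar>) \<le> B)"

definition periodic_bv :: "(real \<Rightarrow> real) set" where
  "periodic_bv = {f. (\<forall>x. f (x + 1) = f x) \<and> bounded_var_on 0 1 f}"

definition supp :: "'w measure \<Rightarrow> ('w \<Rightarrow> int) \<Rightarrow> int set" where
  "supp M Y = {n. measure M {w \<in> space M. Y w = n} > 0}"

definition gcd_diff_supp :: "'w measure \<Rightarrow> ('w \<Rightarrow> int) \<Rightarrow> int" where
  "gcd_diff_supp M Y = Gcd {a - b | a b. a \<in> supp M Y \<and> b \<in> supp M Y}"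

text \<open>The random walk uses the steps with indices starting from 1; \<open>X 0\<close> plays no role.\<close>

definition walk :: "(nat \<Rightarrow> 'w \<Rightarrow> int) \<Rightarrow> nat \<Rightarrow> 'w \<Rightarrow> int" where
  "walk X k w = (\<Sum>j = 1..k. X j w)"

text \<open>
  Let \<open>U\<close> have law \<open>N\<close> and be independent of the steps \<open>X j\<close>. Only the joint law of \<open>U\<close>
  and the steps matters, so \<open>U\<close> is realised as the first coordinate of the product of \<open>N\<close> and \<open>M\<close>.
  Then \<open>corr\<close> is the expectation of \<open>g (U) g (U + S_k \<beta>)\<close>.
\<close>

definition corr ::
  "real measure \<Rightarrow> 'w measure \<Rightarrow> (nat \<Rightarrow> 'w \<Rightarrow> int) \<Rightarrow> real \<Rightarrow> (real \<Rightarrow> real) \<Rightarrow> nat \<Rightarrow> real" where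
  "corr N M X \<beta> g k = (\<integral>(u, w). g u * g (u + of_int (walk X k w) * \<beta>) \<partial>(N \<Otimes>\<^sub>M M))"

definition corr_series ::
  "real measure \<Rightarrow> 'w measure \<Rightarrow> (nat \<Rightarrow> 'w \<Rightarrow> int) \<Rightarrow> real \<Rightarrow> (real \<Rightarrow> real) \<Rightarrow> real" where
  "corr_series N M X \<beta> g = (\<integral>u. (g u)\<^sup>2 \<partial>N) + 2 * (\<Sum>k. corr N M X \<beta> g (Suc k))"

definition circle_unif :: "real measure" where
  "circle_unif = uniform_measure lborel {0..<1}"

definition centered :: "(real \<Rightarrow> real) \<Rightarrow> real \<Rightarrow> real" where
  "centered f x = f x - (LINT t:{0..1}|lborel. f t)"

definition cyclic_unif :: "nat \<Rightarrow> real measure" where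
  "cyclic_unif q = uniform_count_measure ((\<lambda>a. real a / real q) ` {..<q})"

definition centered_cyclic :: "nat \<Rightarrow> (real \<Rightarrow> real) \<Rightarrow> real \<Rightarrow> real" where
  "centered_cyclic q f x = f x - (\<Sum>a<q. f (real a / real q)) / real q"

definition C_irr ::
  "'w measure \<Rightarrow> (nat \<Rightarrow> 'w \<Rightarrow> int) \<Rightarrow> real \<Rightarrow> (real \<Rightarrow> real) \<Rightarrow> real" where
  "C_irr M X \<alpha> f = corr_series circle_unif M X \<alpha> (centered f)"

definition C_rat ::
  "'w measure \<Rightarrow> (nat \<Rightarrow> 'w \<Rightarrow> int) \<Rightarrow> int \<Rightarrow> nat \<Rightarrow> (real \<Rightarrow> real) \<Rightarrow> real" where
  "C_rat M X p q f =
     corr_series (cyclic_unif q) M X (real_of_int p / real q) (centered_cyclic q f)"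

definition best_approx :: "real \<Rightarrow> (int \<times> nat) set" where
  "best_approx \<alpha> = {(p, q). q \<ge> 1 \<and> coprime p (int q) \<and>
     \<bar>real q * \<alpha> - of_int p\<bar> = int_dist (real q * \<alpha>) \<and>
     (\<forall>h::nat. 0 < h \<and> h < q \<longrightarrow> int_dist (real h * \<alpha>) \<ge> int_dist (real q * \<alpha>))}"

text \<open>
  For irrational \<open>\<alpha>\<close> the numerator is determined by the denominator, so the following
  determines the sequences \<open>p\<close> and \<open>q\<close> uniquely.
\<close>

definition best_approx_seq :: "real \<Rightarrow> (nat \<Rightarrow> int) \<Rightarrow> (nat \<Rightarrow> nat) \<Rightarrow> bool" where
  "best_approx_seq \<alpha> p q \<longleftrightarrow> strict_mono q \<and> range (\<lambda>n. (p n, q n)) = best_approx \<alpha>"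

end

theory Submission
  imports Defs
begin

text \<open>
  Write $\|x\|$ for \<^const>\<open>int_dist\<close> and let $\varphi(t)$ be the expectation of $e^{2\pi i t X_1}$
  (\<open>chf\<close> below). Since $e^{2\pi i t S_k}$ has expectation $\varphi(t)^k$, both constants diagonalise in
  the Fourier basis: with $T(z) = 1 + 2z/(1-z)$, which is the value of $1 + 2\sum_{k \ge 1} z^k$,
  the constant at $p/q$ is the sum of $|c_q(h)|^2\, T(\varphi(hp/q))$ over a balanced set of residues $h$
  modulo $q$, where $c_q$ is the finite Fourier transform of the centred $f$, and the constant at $\alpha$ is
  the sum of $|c(h)|^2\, T(\varphi(h\alpha))$ over all integers $h$, where $c(h)$ are the Fourier coefficients.
  Each term of the first sum tends to the corresponding term of the second one, so the whole point is to
  dominate the terms.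

  Two bounds do this. Summation by parts gives $|c_q(h)|^2 \le K/h^2$ uniformly in $q$ (\<open>weight_bound\<close>).
  As $X_1$ has a nonzero mean, $\varphi$ approaches the value $1$ no faster than linearly, and $|\varphi(t)| = 1$
  forces $Dt$ to be an integer; by compactness $|1 - \varphi(t)| \ge c\,\|Dt\|$ for all $t$
  (\<open>chf_lower_bound\<close>). Hence the terms are at most a constant times $1/(h^2\,\|Dh\beta\|)$ with
  $\beta = p/q$ or $\beta = \alpha$. For $\beta = \alpha$ these bounds are summable because $\gamma < 2$:
  in a dyadic block of $h$ the points $Dh\alpha$ are well spaced modulo $1$
  (\<open>summable_inverse_square_int_dist\<close>). For $\beta = p/q$ the frequencies are split at $2D|h| = q$.
  Below this threshold, the minimality of best approximations yields $\|Dhp/q\| \ge \|Dh\alpha\|/2$, so the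
  bound for $\alpha$ dominates (\<open>low_frequencies_tendsto\<close>). Above it, $1/h^2$ is of order $1/q^2$
  while $h \mapsto Dhp$ permutes the nonzero residues modulo $q$, so that the remaining terms contribute
  $O(\log q / q)$ (\<open>high_frequencies_bound\<close>); this is where $D$ has to be coprime to $q$.

  The spectral formula at $\alpha$ is obtained without any theory of Fourier series on the circle.
  For a fixed $k$ the correlation at $p/q$ converges to the correlation at $\alpha$, because a function of
  bounded variation has only countably many discontinuities and averages over the grid of multiples of
  $1/q$ are integrals of step functions (\<open>tendsto_grid_average\<close>). The finite Parseval identity, which is
  elementary, then passes to the limit (\<open>corr_circle_eq_integral\<close>).

  Sums over all integers are written as integrals with respect to the counting measure, so that dominated
  convergence applies to them directly.
\<close>

section \<open>Distance to the nearest integer\<close>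

lemma int_dist_le: "int_dist x \<le> \<bar>x - of_int m\<bar>"
  unfolding int_dist_def by (rule round_diff_minimal)

lemma int_dist_nonneg: "0 \<le> int_dist x"
  by (simp add: int_dist_def)

lemma int_dist_le_half: "int_dist x \<le> 1 / 2"
  unfolding int_dist_def using of_int_round_abs_le[of x] by (simp add: abs_minus_commute)

text \<open>
  Comparing with one nearest integer reduces each estimate of a distance to the minimality of
  \<open>int_dist_le\<close>.
\<close>

lemma int_dist_obtain: obtains m :: int where "int_dist x = \<bar>x - of_int m\<bar>"
  unfolding int_dist_def by blast

lemma int_dist_diff_le: "int_dist x \<le> int_dist y + \<bar>x - y\<bar>"
proof -
  obtain m :: int where m: "int_dist y = \<bar>y - of_int m\<bar>" by (rule int_dist_obtain)
  show ?thesis using int_dist_le[of x m] m by linarith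
qed

lemma int_dist_minus: "int_dist (- x) = int_dist x"
proof -
  have *: "int_dist (- z) \<le> int_dist z" for z
  proof -
    obtain m :: int where m: "int_dist z = \<bar>z - of_int m\<bar>" by (rule int_dist_obtain)
    show ?thesis using int_dist_le[of "-z" "-m"] m by simp
  qed
  from *[of x] *[of "-x"] show ?thesis by simp
qed

lemma int_dist_eq_0_iff: "int_dist x = 0 \<longleftrightarrow> x \<in> \<int>"
proof
  assume "int_dist x = 0"
  then have "x = of_int (round x)" by (simp add: int_dist_def)
  then show "x \<in> \<int>" by (metis Ints_of_int)
next
  assume "x \<in> \<int>"
  then show "int_dist x = 0" by (auto elim: Ints_cases simp: int_dist_def)
qed

section \<open>A series with small denominators\<close>

text \<open>
  Numbers that are at least \<open>\<delta>\<close> and pairwise \<open>\<delta>\<close>-separated are as sparse as the multiples of \<open>\<delta>\<close>: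
  \<open>h \<mapsto> \<lfloor>r h / \<delta>\<rfloor>\<close> is injective with positive values. An exponent \<open>s > 1\<close>, harmless
  because \<open>r h \<le> 1\<close>, replaces the logarithm that the harmonic sum would produce by a convergent series.
\<close>

lemma sum_powr_floor_le:
  fixes r :: "nat \<Rightarrow> real" and \<delta> s :: real
  assumes "finite B" "0 < \<delta>" "1 < s"
    and range: "\<And>h. h \<in> B \<Longrightarrow> \<delta> \<le> r h \<and> r h \<le> 1"
    and sep: "\<And>h h'. h \<in> B \<Longrightarrow> h' \<in> B \<Longrightarrow> h \<noteq> h' \<Longrightarrow> \<delta> \<le> \<bar>r h - r h'\<bar>"
  shows "(\<Sum>h\<in>B. 1 / r h) \<le> \<delta> powr (- s) * (\<Sum>k. real k powr (- s))"
proof -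
  define k where "k h = nat \<lfloor>r h / \<delta>\<rfloor>" for h
  have k1: "1 \<le> k h" "real (k h) * \<delta> \<le> r h" "r h < (real (k h) + 1) * \<delta>" if "h \<in> B" for h
  proof -
    have "1 \<le> r h / \<delta>" using range[OF that] assms(2) by simp
    then have f: "1 \<le> \<lfloor>r h / \<delta>\<rfloor>" by simp
    then show "1 \<le> k h" unfolding k_def by linarith
    from f have "0 \<le> \<lfloor>r h / \<delta>\<rfloor>" by linarith
    then have k: "real (k h) = of_int \<lfloor>r h / \<delta>\<rfloor>" unfolding k_def by (rule of_nat_nat)
    have "real (k h) \<le> r h / \<delta>" "r h / \<delta> < real (k h) + 1" unfolding k by linarith+
    then show "real (k h) * \<delta> \<le> r h" "r h < (real (k h) + 1) * \<delta>"
      using assms(2) by (simp_all add: field_simps)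
  qed
  have inj: "inj_on k B"
  proof (rule inj_onI, rule ccontr)
    fix h h' assume *: "h \<in> B" "h' \<in> B" "k h = k h'" "h \<noteq> h'"
    have "\<bar>r h - r h'\<bar> < \<delta>"
      using k1(2,3)[OF *(1)] k1(2,3)[OF *(2)] *(3) by (simp add: algebra_simps)
    with sep[OF *(1,2,4)] show False by simp
  qed
  have summ: "summable (\<lambda>k. real k powr (- s))"
    using assms(3) by (subst summable_real_powr_iff) auto
  have "1 / r h \<le> \<delta> powr (- s) * real (k h) powr (- s)" if h: "h \<in> B" for h
  proof -
    have pos: "0 < r h" using range[OF h] assms(2) by linarith
    have "1 / r h = r h powr (- 1)" using pos by (simp add: powr_minus_divide)
    also have "\<dots> \<le> r h powr (- s)"
      using range[OF h] pos assms(3) by (intro powr_mono') auto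
    also have "\<dots> \<le> (real (k h) * \<delta>) powr (- s)"
      using k1[OF h] assms by (intro powr_mono2') auto
    also have "\<dots> = \<delta> powr (- s) * real (k h) powr (- s)"
      using assms(2) by (simp add: powr_mult)
    finally show ?thesis .
  qed
  then have "(\<Sum>h\<in>B. 1 / r h) \<le> (\<Sum>h\<in>B. \<delta> powr (- s) * real (k h) powr (- s))"
    by (rule sum_mono)
  also have "\<dots> = \<delta> powr (- s) * (\<Sum>h\<in>B. real (k h) powr (- s))"
    by (simp add: sum_distrib_left)
  also have "(\<Sum>h\<in>B. real (k h) powr (- s)) = (\<Sum>j\<in>k ` B. real j powr (- s))"
    using inj by (simp add: sum.reindex)
  also have "\<dots> \<le> (\<Sum>k. real k powr (- s))"
    using assms(1) by (intro sum_le_suminf summ) auto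
  finally show ?thesis by (simp add: mult_left_mono)
qed

text \<open>
  In the block \<open>2\<^sup>m \<le> h < 2\<^sup>m\<^sup>+\<^sup>1\<close> both the indices and their differences are below \<open>2\<^sup>m\<^sup>+\<^sup>1\<close>, so
  that the signed distances of \<open>h * \<beta>\<close> to the nearest integer have absolute value and mutual gaps at
  least \<open>\<delta>\<close>, which is of order \<open>2\<close> to the power \<open>- m * \<gamma>\<close>. The block then contributes at most a
  constant times \<open>2\<close> to the power \<open>m * (\<gamma> * s - 2)\<close>, a geometric sequence in \<open>m\<close>.
\<close>

lemma summable_inverse_square_int_dist:
  fixes \<beta> \<gamma> c :: real
  assumes "0 < c" "0 < \<gamma>" "\<gamma> < 2"
    and low: "\<And>n::nat. 1 \<le> n \<Longrightarrow> c * real n powr (- \<gamma>) \<le> int_dist (real n * \<beta>)"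
  shows "summable (\<lambda>h::nat. 1 / ((real h)\<^sup>2 * int_dist (real h * \<beta>)))"
proof -
  define g where "g h = 1 / ((real h)\<^sup>2 * int_dist (real h * \<beta>))" for h :: nat
  \<comment> \<open>Any \<open>s > 1\<close> with \<open>\<gamma> * s < 2\<close> would do; this one has \<open>\<gamma> * s = 1 + \<gamma> / 2\<close>.\<close>
  define s where "s = 1 + (2 / \<gamma> - 1) / 2"
  have s1: "1 < s" using assms by (simp add: s_def field_simps)
  have gs: "\<gamma> * s < 2" using assms by (simp add: s_def field_simps)
  define S where "S = (\<Sum>k. real k powr (- s))"
  define \<rho> where "\<rho> = 2 powr (\<gamma> * s - 2)"
  have \<rho>: "0 < \<rho>" "\<rho> < 1" using gs by (auto simp: \<rho>_def powr_less_one)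
  define K where "K = 2 * S * c powr (- s) * 2 powr (\<gamma> * s)"
  have S0: "0 \<le> S" unfolding S_def
    by (rule suminf_nonneg) (use s1 in \<open>auto simp: summable_real_powr_iff\<close>)
  have g0: "0 \<le> g h" for h by (simp add: g_def int_dist_nonneg)
  have block: "(\<Sum>h\<in>{2^m..<2^(Suc m)}. g h) \<le> K * \<rho> ^ m" for m
  proof -
    define B :: "nat set" where "B = {2^m..<2^(Suc m)}"
    define \<delta> where "\<delta> = c * (2 ^ Suc m) powr (- \<gamma>)"
    have \<delta>: "0 < \<delta>" using assms by (simp add: \<delta>_def)
    have big: "\<delta> \<le> int_dist (real n * \<beta>)" if "1 \<le> n" "n < 2 ^ Suc m" for n :: nat
    proof -
      have "real n < 2 ^ Suc m" using that(2) by (metis of_nat_less_iff of_nat_numeral of_nat_power)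
      then have "(2 ^ Suc m) powr (- \<gamma>) \<le> real n powr (- \<gamma>)"
        using that assms by (intro powr_mono2') auto
      then have "\<delta> \<le> c * real n powr (- \<gamma>)" unfolding \<delta>_def
        using assms(1) by (intro mult_left_mono) auto
      also note low[OF that(1)]
      finally show ?thesis .
    qed
    have B1: "1 \<le> h" "h < 2 ^ Suc m" "2 ^ m \<le> h" if "h \<in> B" for h
    proof -
      show "h < 2 ^ Suc m" "2 ^ m \<le> h" using that by (auto simp: B_def)
      then show "1 \<le> h" by (metis le_trans one_le_numeral one_le_power)
    qed
    define x where "x h = real h * \<beta> - of_int (round (real h * \<beta>))" for h
    have absx: "\<bar>x h\<bar> = int_dist (real h * \<beta>)" for h by (simp add: x_def int_dist_def)
    have sepx: "\<delta> \<le> \<bar>x h - x h'\<bar>" if hB: "h \<in> B" "h' \<in> B" "h' < h" for h h'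
    proof -
      have "\<delta> \<le> int_dist (real (h - h') * \<beta>)"
        using B1[OF hB(1)] hB(3) by (intro big) auto
      also have "\<dots> \<le> \<bar>real (h - h') * \<beta> - of_int (round (real h * \<beta>) - round (real h' * \<beta>))\<bar>"
        by (rule int_dist_le)
      also have "\<dots> = \<bar>x h - x h'\<bar>" using hB(3)
        by (simp add: x_def of_nat_diff algebra_simps)
      finally show ?thesis .
    qed
    have sepx': "\<delta> \<le> \<bar>x h - x h'\<bar>" if hB: "h \<in> B" "h' \<in> B" "h \<noteq> h'" for h h'
      using sepx[of h h'] sepx[of h' h] that by (cases "h < h'") (auto simp: abs_minus_commute)
    \<comment> \<open>Positive and negative distances are treated separately, because the gap between two signed
        distances is the gap between their absolute values only when the signs agree.\<close>
    have half: "(\<Sum>h\<in>{h\<in>B. P (x h)}. 1 / \<bar>x h\<bar>) \<le> \<delta> powr (- s) * S"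
      if P: "\<And>u v. P u \<Longrightarrow> P v \<Longrightarrow> \<bar>u - v\<bar> = \<bar>\<bar>u\<bar> - \<bar>v\<bar>\<bar>" for P :: "real \<Rightarrow> bool"
      unfolding S_def
    proof (rule sum_powr_floor_le)
      show "finite {h\<in>B. P (x h)}" by (simp add: B_def)
      show "\<delta> \<le> \<bar>x h\<bar> \<and> \<bar>x h\<bar> \<le> 1" if "h \<in> {h\<in>B. P (x h)}" for h
        using that big[of h] B1[of h] int_dist_le_half[of "real h * \<beta>"] by (auto simp: absx)
      show "\<delta> \<le> \<bar>\<bar>x h\<bar> - \<bar>x h'\<bar>\<bar>"
        if "h \<in> {h\<in>B. P (x h)}" "h' \<in> {h\<in>B. P (x h)}" "h \<noteq> h'" for h h'
        using sepx'[of h h'] that P[of "x h" "x h'"] by auto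
    qed (use \<delta> s1 in auto)
    have "(\<Sum>h\<in>B. 1 / \<bar>x h\<bar>) = (\<Sum>h\<in>{h\<in>B. 0 \<le> x h}. 1 / \<bar>x h\<bar>) + (\<Sum>h\<in>{h\<in>B. x h < 0}. 1 / \<bar>x h\<bar>)"
      by (subst sum.union_disjoint[symmetric]) (auto simp: B_def intro: sum.cong)
    also have "\<dots> \<le> \<delta> powr (- s) * S + \<delta> powr (- s) * S"
      by (intro add_mono half[of "\<lambda>u. 0 \<le> u"] half[of "\<lambda>u. u < 0"]) auto
    finally have sumx: "(\<Sum>h\<in>B. 1 / \<bar>x h\<bar>) \<le> 2 * S * \<delta> powr (- s)" by simp
    have "(\<Sum>h\<in>B. g h) \<le> (\<Sum>h\<in>B. 1 / (2 ^ m)\<^sup>2 * (1 / \<bar>x h\<bar>))"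
    proof (rule sum_mono)
      fix h assume h: "h \<in> B"
      have "(2::real) ^ m \<le> real h"
        using B1(3)[OF h] by (metis of_nat_le_iff of_nat_numeral of_nat_power)
      then have "((2::real) ^ m)\<^sup>2 \<le> (real h)\<^sup>2" by (intro power_mono) auto
      moreover have "0 < \<bar>x h\<bar>" using big[OF B1(1,2)[OF h]] \<delta> by (simp add: absx)
      ultimately show "g h \<le> 1 / (2 ^ m)\<^sup>2 * (1 / \<bar>x h\<bar>)"
        unfolding g_def absx[symmetric]
        using B1(1)[OF h] by (simp add: frac_le mult_mono)
    qed
    also have "\<dots> \<le> 1 / (2 ^ m)\<^sup>2 * (2 * S * \<delta> powr (- s))"
      unfolding sum_distrib_left[symmetric] by (intro mult_left_mono sumx) auto
    also have "\<dots> = K * \<rho> ^ m"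
    proof -
      have p: "(2::real) ^ Suc m = 2 powr (real m + 1)" by (simp add: powr_add powr_realpow)
      have d: "\<delta> powr (- s) = c powr (- s) * 2 powr (\<gamma> * s * (real m + 1))"
        unfolding \<delta>_def p using assms(1) by (simp add: powr_mult powr_powr algebra_simps)
      have q: "1 / ((2::real) ^ m)\<^sup>2 = 2 powr (- 2 * real m)"
        by (simp add: powr_minus_divide powr_realpow[symmetric] power2_eq_square powr_add[symmetric])
      have r: "\<rho> ^ m = 2 powr ((\<gamma> * s - 2) * real m)"
        by (simp add: \<rho>_def powr_realpow[symmetric] powr_powr)
      have "(2::real) powr (- 2 * real m) * 2 powr (\<gamma> * s * (real m + 1))
          = 2 powr (\<gamma> * s) * 2 powr ((\<gamma> * s - 2) * real m)"
        by (simp add: powr_add[symmetric] algebra_simps)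
      then show ?thesis unfolding q d r K_def by (simp add: mult_ac)
    qed
    finally show ?thesis by (simp add: B_def)
  qed
  have dy: "(\<Sum>h<2^m. g h) = (\<Sum>i<m. \<Sum>h\<in>{2^i..<2^(Suc i)}. g h)" for m
  proof (induction m)
    case 0
    show ?case by (simp add: g_def)
  next
    case (Suc m)
    have "(\<Sum>h<2^Suc m. g h) = (\<Sum>h<2^m. g h) + (\<Sum>h\<in>{2^m..<2^(Suc m)}. g h)"
      unfolding lessThan_atLeast0
      by (rule sum.atLeastLessThan_concat[symmetric]) auto
    then show ?case using Suc by simp
  qed
  have K0: "0 \<le> K" unfolding K_def using S0 by simp
  have "summable g"
  proof (rule summableI_nonneg_bounded[OF g0])
    fix n
    have "(\<Sum>h<n. g h) \<le> (\<Sum>h<2^n. g h)"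
      by (rule sum_mono2) (use g0 less_exp[of n] in auto)
    also have "\<dots> \<le> (\<Sum>i<n. K * \<rho> ^ i)" unfolding dy by (intro sum_mono block)
    also have "\<dots> \<le> (\<Sum>i. K * \<rho> ^ i)"
      using \<rho> K0 by (intro sum_le_suminf summable_mult summable_geometric) auto
    finally show "(\<Sum>h<n. g h) \<le> (\<Sum>i. K * \<rho> ^ i)" .
  qed
  then show ?thesis by (simp add: g_def[abs_def])
qed

section \<open>The characteristic function of one step\<close>

definition turn :: "real \<Rightarrow> complex" where
  "turn x = cis (2 * pi * x)"

lemma norm_turn [simp]: "norm (turn x) = 1"
  by (simp add: turn_def)

lemma turn_0 [simp]: "turn 0 = 1"
  by (simp add: turn_def)

lemma turn_add: "turn (x + y) = turn x * turn y"
  by (simp add: turn_def cis_mult distrib_left)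

lemma turn_minus: "turn (- x) = cnj (turn x)"
  by (simp add: turn_def cis_cnj)

lemma turn_eq_1_iff: "turn x = 1 \<longleftrightarrow> x \<in> \<int>"
proof
  assume "turn x = 1"
  then have "cos (2 * pi * x) = 1" by (simp add: turn_def complex_eq_iff)
  then obtain n :: int where "2 * pi * x = of_int n * 2 * pi"
    by (auto simp: cos_one_2pi_int)
  then have "x = of_int n" by simp
  then show "x \<in> \<int>" by simp
next
  assume "x \<in> \<int>"
  then show "turn x = 1"
    by (auto elim!: Ints_cases simp: turn_def cis_multiple_2pi)
qed

lemma turn_power: "turn x ^ n = turn (real n * x)"
  by (simp add: turn_def Complex.DeMoivre mult_ac)

lemma continuous_turn [continuous_intros]:
  "continuous F f \<Longrightarrow> continuous F (\<lambda>x. turn (f x))"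
  unfolding turn_def cis_conv_exp by (intro continuous_intros)

lemma isCont_turn: "isCont turn x"
  by (intro continuous_intros)

lemma measurable_turn [measurable]: "turn \<in> borel_measurable borel"
  by (rule borel_measurable_continuous_onI) (simp add: continuous_at_imp_continuous_on isCont_turn)

lemma norm_turn_minus_1_le: "norm (turn x - 1) \<le> 2 * pi * \<bar>x\<bar>"
proof -
  have "norm (turn x - 1) = 2 * \<bar>sin (pi * x)\<bar>"
    using dist_exp_i_1[of "2 * pi * x"] by (simp add: turn_def cis_conv_exp)
  also have "\<dots> \<le> 2 * \<bar>pi * x\<bar>"
    using abs_sin_x_le_abs_x[of "pi * x"] by simp
  finally show ?thesis by (simp add: abs_mult)
qed

text \<open>
  The chord of an angle of at most half a turn is comparable to its arc; the constant \<open>1\<close> is far from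
  optimal but convenient.
\<close>

lemma norm_turn_minus_1_ge:
  assumes "\<bar>x\<bar> \<le> 1 / 2"
  shows "\<bar>x\<bar> \<le> norm (turn x - 1)"
proof -
  have eq: "norm (turn x - 1) = 2 * \<bar>sin (pi * x)\<bar>"
    using dist_exp_i_1[of "2 * pi * x"] by (simp add: turn_def cis_conv_exp)
  have "0 \<le> sin (pi * \<bar>x\<bar>)"
    using assms mult_left_mono[of "\<bar>x\<bar>" 1 pi] by (intro sin_ge_zero) auto
  then have "\<bar>sin (pi * x)\<bar> = sin (pi * \<bar>x\<bar>)"
    by (cases "0 \<le> x") auto
  moreover have "\<bar>x\<bar> \<le> 2 * sin (pi * \<bar>x\<bar>)"
  proof (cases "\<bar>x\<bar> \<le> 1 / 3")
    case True
    show ?thesis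
    proof (cases "x = 0")
      case False
      then have "0 < pi * \<bar>x\<bar>" by simp
      then obtain z where z: "0 < z" "z < pi * \<bar>x\<bar>" "sin (pi * \<bar>x\<bar>) = pi * \<bar>x\<bar> * cos z"
        using MVT2[of 0 "pi * \<bar>x\<bar>" sin cos] by (auto intro: DERIV_sin)
      have "z \<le> pi / 3" using z(2) mult_left_mono[OF True, of pi] pi_ge_zero by linarith
      then have "cos (pi / 3) \<le> cos z" using z(1) by (intro cos_monotone_0_pi_le) auto
      then have "pi * \<bar>x\<bar> * (1 / 2) \<le> sin (pi * \<bar>x\<bar>)"
        unfolding z(3) by (intro mult_left_mono) (auto simp: cos_60)
      moreover have "1 * \<bar>x\<bar> \<le> pi * \<bar>x\<bar>" using pi_ge_two by (intro mult_right_mono) auto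
      ultimately show ?thesis by simp
    qed simp
  next
    case False
    have "sin (pi / 6) \<le> sin (pi * \<bar>x\<bar>)"
      using False assms pi_gt_zero by (intro sin_monotone_2pi_le) (auto simp: field_simps)
    then show ?thesis using assms by (simp add: sin_30)
  qed
  ultimately show ?thesis using eq by simp
qed

definition chf :: "'w measure \<Rightarrow> ('w \<Rightarrow> int) \<Rightarrow> real \<Rightarrow> complex" where
  "chf M Y t = (\<integral>w. turn (t * of_int (Y w)) \<partial>M)"

lemma tendsto_turn_quotient:
  assumes "s \<longlonglongrightarrow> 0" "\<And>n. s n \<noteq> (0::real)"
  shows "(\<lambda>n. (turn (s n * x) - 1) / of_real (s n)) \<longlonglongrightarrow> \<i> * of_real (2 * pi * x)"
proof -
  define c where "c = \<i> * complex_of_real (2 * pi * x)"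
  have "((\<lambda>z. exp (c * z)) has_field_derivative c) (at 0)"
    by (auto intro!: derivative_eq_intros)
  then have "(\<lambda>h. (exp (c * h) - 1) / h) \<midarrow>0\<rightarrow> c"
    by (simp add: DERIV_def)
  moreover have "filterlim (\<lambda>n. complex_of_real (s n)) (at 0) sequentially"
    using assms by (auto simp: filterlim_at intro!: tendsto_eq_intros)
  ultimately have "(\<lambda>n. (exp (c * of_real (s n)) - 1) / of_real (s n)) \<longlonglongrightarrow> c"
    by (rule filterlim_compose)
  moreover have "exp (c * of_real (s n)) = turn (s n * x)" for n
    by (simp add: c_def turn_def cis_conv_exp mult_ac)
  ultimately show ?thesis by (simp add: c_def)
qed

text \<open>
  A nonzero multiple of \<open>t\<close> being an integer, \<open>t\<close> is a fraction, and then its reduced denominator divides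
  every element of \<open>A\<close>.
\<close>

lemma Gcd_multiple_in_Ints:
  fixes t :: real and A :: "int set"
  assumes "\<And>m. m \<in> A \<Longrightarrow> t * of_int m \<in> \<int>" "m0 \<in> A" "m0 \<noteq> 0"
  shows "t * of_int (Gcd A) \<in> \<int>"
proof -
  obtain k where k: "t * of_int m0 = of_int k" using assms(1,2) by (metis Ints_cases)
  then have "t = of_int k / of_int m0" using assms(3) by (simp add: field_simps)
  then have "t \<in> \<rat>" by simp
  then obtain u v :: int where uv: "0 < v" "coprime u v" "t = of_int u / of_int v"
    by (metis Rats_cases' )
  have "v dvd m" if m: "m \<in> A" for m
  proof -
    obtain j where "t * of_int m = of_int j" using assms(1)[OF m] by (metis Ints_cases)
    then have "of_int (u * m) = (of_int (j * v) :: real)" using uv by (simp add: field_simps)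
    then have "u * m = j * v" by (simp only: of_int_eq_iff)
    then have "v dvd u * m" by simp
    with uv(2) show ?thesis by (simp add: coprime_dvd_mult_right_iff coprime_commute)
  qed
  then have "v dvd Gcd A" by (rule Gcd_greatest)
  then obtain j where "Gcd A = v * j" by (elim dvdE)
  then have "t * of_int (Gcd A) = of_int (u * j)" using uv by simp
  then show ?thesis by (metis Ints_of_int)
qed

context prob_space begin

context
  fixes Y :: "'a \<Rightarrow> int"
  assumes Y [measurable]: "Y \<in> measurable M (count_space UNIV)"
begin

lemma integrable_turn: "integrable M (\<lambda>w. turn (t * of_int (Y w)))"
  by (rule integrable_const_bound[where B = 1]) auto

lemma norm_chf_le_1: "norm (chf M Y t) \<le> 1"
proof -
  have "norm (chf M Y t) \<le> (\<integral>w. norm (turn (t * of_int (Y w))) \<partial>M)"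
    unfolding chf_def by (rule integral_norm_bound)
  then show ?thesis by (simp add: prob_space)
qed

lemma tendsto_chf:
  assumes "t \<longlonglongrightarrow> t0"
  shows "(\<lambda>n. chf M Y (t n)) \<longlonglongrightarrow> chf M Y t0"
  unfolding chf_def
proof (rule integral_dominated_convergence[where w = "\<lambda>_. 1"])
  show "AE w in M. (\<lambda>n. turn (t n * of_int (Y w))) \<longlonglongrightarrow> turn (t0 * of_int (Y w))"
    by (intro AE_I2 isCont_tendsto_compose[OF isCont_turn] tendsto_intros assms)
qed auto

text \<open>
  Equality in the triangle inequality: a random variable with values in the unit disc whose mean has
  modulus \<open>1\<close> is almost surely constant.
\<close>

lemma chf_unimodular_imp_AE:
  assumes "norm (chf M Y t) = 1"
  shows "AE w in M. turn (t * of_int (Y w)) = chf M Y t"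
proof -
  define \<omega> where "\<omega> = chf M Y t"
  have \<omega>: "cnj \<omega> * \<omega> = 1"
    using assms by (simp add: \<omega>_def complex_norm_square[symmetric] mult.commute)
  define Z where "Z w = cnj \<omega> * turn (t * of_int (Y w))" for w
  have nZ: "norm (Z w) = 1" for w
    using assms by (simp add: Z_def norm_mult \<omega>_def)
  have iZ: "integrable M Z" unfolding Z_def[abs_def] by (intro integrable_mult_right integrable_turn)
  have "(\<integral>w. Z w \<partial>M) = 1"
    using \<omega> unfolding Z_def by (simp add: integrable_turn \<omega>_def chf_def[symmetric])
  then have "(\<integral>w. 1 - Re (Z w) \<partial>M) = 0"
    using iZ by (simp add: prob_space)
  moreover have "integrable M (\<lambda>w. 1 - Re (Z w))" using iZ by simp
  moreover have "0 \<le> 1 - Re (Z w)" for w using complex_Re_le_cmod[of "Z w"] nZ[of w] by simp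
  ultimately have "AE w in M. 1 - Re (Z w) = 0"
    by (subst (asm) integral_nonneg_eq_0_iff_AE) auto
  then show ?thesis
  proof eventually_elim
    case (elim w)
    then have "Re (Z w) = 1" by simp
    moreover from this nZ[of w] have "Im (Z w) = 0" by (simp add: cmod_def)
    ultimately have Z1: "Z w = 1" by (simp add: complex_eq_iff)
    have "turn (t * of_int (Y w)) = (cnj \<omega> * \<omega>) * turn (t * of_int (Y w))" by (simp add: \<omega>)
    also have "\<dots> = \<omega> * Z w" by (simp add: Z_def mult_ac)
    finally show ?case using Z1 by (simp add: \<omega>_def)
  qed
qed

lemma AE_imp_on_supp:
  assumes "AE w in M. P (Y w)" "a \<in> supp M Y"
  shows "P a"
proof (rule ccontr)
  assume "\<not> P a"
  then have "AE w in M. w \<notin> {w \<in> space M. Y w = a}" using assms(1) by (auto elim: eventually_mono)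
  then have "prob {w \<in> space M. Y w = a} = 0"
    by (subst prob_eq_0) auto
  with assms(2) show False by (simp add: supp_def)
qed

lemma AE_in_supp: "AE w in M. Y w \<in> supp M Y"
proof -
  have "AE w in M. \<forall>a. a \<notin> supp M Y \<longrightarrow> Y w \<noteq> a"
  proof (subst AE_all_countable, intro allI)
    fix a
    show "AE w in M. a \<notin> supp M Y \<longrightarrow> Y w \<noteq> a"
    proof (cases "a \<in> supp M Y")
      case False
      then have "prob {w \<in> space M. Y w = a} = 0"
        using measure_nonneg[of M "{w \<in> space M. Y w = a}"] by (simp add: supp_def)
      then have "AE w in M. w \<notin> {w \<in> space M. Y w = a}" by (subst (asm) prob_eq_0) auto
      then show ?thesis using AE_space by eventually_elim auto
    qed simp
  qed
  then show ?thesis by eventually_elim auto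
qed

lemma nondegenerate_supp:
  assumes "\<not> (\<exists>c. AE w in M. Y w = c)"
  obtains a b where "a \<in> supp M Y" "b \<in> supp M Y" "a \<noteq> b"
proof -
  have "\<exists>a\<in>supp M Y. \<exists>b\<in>supp M Y. a \<noteq> b"
  proof (rule ccontr)
    assume "\<not> ?thesis"
    then obtain c where "supp M Y \<subseteq> {c}" by blast
    then have "AE w in M. Y w = c" using AE_in_supp by (auto elim: eventually_mono)
    with assms show False by blast
  qed
  with that show ?thesis by blast
qed

lemma gcd_diff_supp_pos:
  assumes "\<not> (\<exists>c. AE w in M. Y w = c)"
  shows "0 < gcd_diff_supp M Y"
proof -
  obtain a b where ab: "a \<in> supp M Y" "b \<in> supp M Y" "a \<noteq> b"
    by (rule nondegenerate_supp[OF assms])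
  define A where "A = {a - b | a b. a \<in> supp M Y \<and> b \<in> supp M Y}"
  have "a - b \<in> A" using ab by (auto simp: A_def)
  then have "Gcd A dvd a - b" by (rule Gcd_dvd)
  then have "Gcd A \<noteq> 0" using ab(3) by (auto simp del: Gcd_0_iff)
  moreover have "0 \<le> Gcd A" by simp
  ultimately show ?thesis by (simp add: gcd_diff_supp_def A_def less_le)
qed

text \<open>
  If \<open>t * Y\<close> is almost surely constant modulo \<open>1\<close>, then \<open>t\<close> times any difference of two values of
  \<open>Y\<close> is an integer, and hence so is \<open>t\<close> times their gcd.
\<close>

lemma chf_unimodular_imp_Ints:
  assumes "\<not> (\<exists>c. AE w in M. Y w = c)" "norm (chf M Y t) = 1"
  shows "of_int (gcd_diff_supp M Y) * t \<in> \<int>"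
proof -
  obtain a b where ab: "a \<in> supp M Y" "b \<in> supp M Y" "a \<noteq> b"
    by (rule nondegenerate_supp[OF assms(1)])
  have on_supp: "turn (t * of_int x) = chf M Y t" if "x \<in> supp M Y" for x
    by (rule AE_imp_on_supp[OF chf_unimodular_imp_AE[OF assms(2)] that])
  have "t * of_int (x - y) \<in> \<int>" if "x \<in> supp M Y" "y \<in> supp M Y" for x y
  proof -
    have "turn (t * of_int (x - y)) * turn (t * of_int y) = turn (t * of_int x)"
      by (simp add: turn_add[symmetric] algebra_simps)
    then have "turn (t * of_int (x - y)) * chf M Y t = chf M Y t" using that by (simp add: on_supp)
    moreover have "chf M Y t \<noteq> 0" using assms(2) by auto
    ultimately show ?thesis by (simp add: turn_eq_1_iff)
  qed
  then have "t * of_int (gcd_diff_supp M Y) \<in> \<int>"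
    unfolding gcd_diff_supp_def
    by (intro Gcd_multiple_in_Ints[where ?m0.0 = "a - b"]) (use ab in auto)
  then show ?thesis by (simp add: mult.commute)
qed

lemma chf_periodic:
  assumes "of_int n = u - t"
  shows "chf M Y t = chf M Y u"
proof -
  have "turn (u * of_int (Y w)) = turn (t * of_int (Y w))" for w
  proof -
    have "u * of_int (Y w) = t * of_int (Y w) + of_int (n * Y w)"
      unfolding of_int_mult assms by (simp add: algebra_simps)
    moreover have "turn (of_int (n * Y w)) = 1" by (subst turn_eq_1_iff) simp
    ultimately show ?thesis by (simp add: turn_add)
  qed
  then show ?thesis by (simp add: chf_def)
qed

text \<open>
  The derivative at \<open>0\<close> of the characteristic function, along sequences. The bound
  \<open>2 * pi * \<bar>Y\<bar>\<close> on the difference quotients makes a first moment sufficient.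
\<close>

lemma tendsto_chf_quotient:
  assumes int: "integrable M (\<lambda>w. real_of_int (Y w))" and s: "s \<longlonglongrightarrow> 0" "\<And>n. s n \<noteq> (0::real)"
  shows "(\<lambda>n. (chf M Y (s n) - 1) / of_real (s n)) \<longlonglongrightarrow>
    \<i> * of_real (2 * pi * (\<integral>w. real_of_int (Y w) \<partial>M))"
proof -
  have "(\<lambda>n. \<integral>w. (turn (s n * of_int (Y w)) - 1) / of_real (s n) \<partial>M) \<longlonglongrightarrow>
    (\<integral>w. \<i> * of_real (2 * pi * of_int (Y w)) \<partial>M)"
  proof (rule integral_dominated_convergence[where w = "\<lambda>w. 2 * pi * \<bar>of_int (Y w)\<bar>"])
    show "integrable M (\<lambda>w. 2 * pi * \<bar>real_of_int (Y w)\<bar>)"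
      using int by (intro integrable_mult_right integrable_abs)
    show "AE w in M. (\<lambda>n. (turn (s n * of_int (Y w)) - 1) / of_real (s n)) \<longlonglongrightarrow>
        \<i> * of_real (2 * pi * of_int (Y w))"
      by (intro AE_I2 tendsto_turn_quotient s)
    show "AE w in M. norm ((turn (s n * of_int (Y w)) - 1) / of_real (s n)) \<le> 2 * pi * \<bar>of_int (Y w)\<bar>" for n
    proof (rule AE_I2)
      fix w
      show "norm ((turn (s n * of_int (Y w)) - 1) / of_real (s n)) \<le> 2 * pi * \<bar>of_int (Y w)\<bar>"
        using norm_turn_minus_1_le[of "s n * of_int (Y w)"] s(2)[of n]
        by (simp add: norm_divide field_simps abs_mult)
    qed
  qed auto
  moreover have "(\<integral>w. (turn (s n * of_int (Y w)) - 1) / of_real (s n) \<partial>M) = (chf M Y (s n) - 1) / of_real (s n)" for n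
    using integrable_turn by (simp add: chf_def prob_space)
  moreover have "(\<integral>w. \<i> * complex_of_real (2 * pi * of_int (Y w)) \<partial>M) = \<i> * of_real (2 * pi * (\<integral>w. real_of_int (Y w) \<partial>M))"
    by (simp only: integral_mult_right_zero integral_complex_of_real)
  ultimately show ?thesis by (simp only:)
qed

text \<open>
  Otherwise there are \<open>u n\<close> in \<open>[0, 1]\<close> at which the distance exceeds \<open>Suc n\<close> times the right side. At a
  limit point \<open>t0\<close> the characteristic function equals \<open>1\<close>, so it is periodic with period \<open>t0\<close> and
  \<open>D * t0\<close> is an integer. The difference quotients at \<open>0\<close> along \<open>u n - t0\<close> would then tend to \<open>0\<close>,
  against the nonzero mean.
\<close>

lemma chf_lower_bound:
  assumes nd: "\<not> (\<exists>c. AE w in M. Y w = c)"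
    and int: "integrable M (\<lambda>w. real_of_int (Y w))" and mean: "(\<integral>w. real_of_int (Y w) \<partial>M) \<noteq> 0"
  obtains c where "0 < c" "\<And>t. c * int_dist (of_int (gcd_diff_supp M Y) * t) \<le> norm (1 - chf M Y t)"
proof (rule ccontr)
  assume "\<not> thesis"
  define D where "D = gcd_diff_supp M Y"
  have D: "0 < D" unfolding D_def by (rule gcd_diff_supp_pos[OF nd])
  have "\<exists>t. norm (1 - chf M Y t) < 1 / real (Suc n) * int_dist (of_int D * t)" for n
  proof (rule ccontr)
    assume "\<not> ?thesis"
    then have "thesis" by (intro that[of "1 / real (Suc n)"]) (auto simp: D_def not_less)
    with \<open>\<not> thesis\<close> show False by simp
  qed
  then obtain t where t: "norm (1 - chf M Y (t n)) < 1 / real (Suc n) * int_dist (of_int D * t n)" for n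
    by metis
  \<comment> \<open>Both sides have period 1 in the frequency, so the sequence may be moved into a compact interval.\<close>
  define u where "u n = frac (t n)" for n
  have ut: "of_int \<lfloor>t n\<rfloor> = t n - u n" for n by (simp add: u_def frac_def)
  have u: "norm (1 - chf M Y (u n)) < 1 / real (Suc n) * int_dist (of_int D * u n)" for n
  proof -
    have "int_dist (of_int D * t n) \<le> int_dist (of_int D * u n)"
    proof -
      obtain m :: int where m: "int_dist (of_int D * u n) = \<bar>of_int D * u n - of_int m\<bar>"
        by (rule int_dist_obtain)
      have "int_dist (of_int D * t n) \<le> \<bar>of_int D * t n - of_int (m + D * \<lfloor>t n\<rfloor>)\<bar>"
        by (rule int_dist_le)
      also have "of_int D * t n - of_int (m + D * \<lfloor>t n\<rfloor>) = of_int D * u n - of_int m"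
        by (simp add: ut algebra_simps)
      finally show ?thesis using m by simp
    qed
    then have "1 / real (Suc n) * int_dist (of_int D * t n) \<le> 1 / real (Suc n) * int_dist (of_int D * u n)"
      by (intro mult_left_mono) auto
    with t[of n] show ?thesis by (simp add: chf_periodic[OF ut[of n]])
  qed
  have "\<forall>n. u n \<in> {0..1}" by (simp add: u_def less_imp_le[OF frac_lt_1])
  then obtain t0 r where r: "strict_mono r" "(u \<circ> r) \<longlonglongrightarrow> t0"
    using compact_Icc[of 0 "1::real"] unfolding compact_def by metis
  have inv: "(\<lambda>n. 1 / real (Suc (r n))) \<longlonglongrightarrow> 0"
    using LIMSEQ_subseq_LIMSEQ[OF LIMSEQ_Suc[OF lim_1_over_n] r(1)] by (simp add: o_def)
  have bd: "norm (1 - chf M Y (u (r n))) \<le> 1 / real (Suc (r n))" for n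
  proof -
    have "1 / real (Suc (r n)) * int_dist (of_int D * u (r n)) \<le> 1 / real (Suc (r n)) * 1"
      using int_dist_le_half[of "of_int D * u (r n)"] by (intro mult_left_mono) auto
    with u[of "r n"] show ?thesis by simp
  qed
  have "(\<lambda>n. norm (1 - chf M Y (u (r n)))) \<longlonglongrightarrow> norm (1 - chf M Y t0)"
    by (intro tendsto_intros tendsto_chf) (use r(2) in \<open>simp add: o_def\<close>)
  moreover have "(\<lambda>n. norm (1 - chf M Y (u (r n)))) \<longlonglongrightarrow> 0"
    by (rule tendsto_sandwich[OF _ _ tendsto_const inv]) (intro always_eventually allI bd norm_ge_zero)+
  ultimately have chf0: "chf M Y t0 = 1"
    using LIMSEQ_unique by fastforce
  have Dt0: "of_int D * t0 \<in> \<int>" unfolding D_def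
    by (rule chf_unimodular_imp_Ints[OF nd]) (simp add: chf0)
  define s where "s n = u (r n) - t0" for n
  have s0: "s \<longlonglongrightarrow> 0" using r(2) unfolding s_def o_def by (simp add: LIM_zero)
  have dist_s: "int_dist (of_int D * u (r n)) \<le> of_int D * \<bar>s n\<bar>" for n
  proof -
    have "int_dist (of_int D * u (r n)) \<le> int_dist (of_int D * t0) + \<bar>of_int D * u (r n) - of_int D * t0\<bar>"
      by (rule int_dist_diff_le)
    also have "\<dots> = of_int D * \<bar>s n\<bar>"
      using Dt0 D by (simp add: int_dist_eq_0_iff[THEN iffD2] s_def right_diff_distrib[symmetric] abs_mult)
    finally show ?thesis .
  qed
  have AE0: "AE w in M. turn (t0 * of_int (Y w)) = 1"
    using chf_unimodular_imp_AE[of t0] by (simp add: chf0)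
  \<comment> \<open>As \<open>t0 * Y\<close> is almost surely an integer, shifting the frequency by \<open>t0\<close> changes nothing.\<close>
  have chf_s: "chf M Y (u (r n)) = chf M Y (s n)" for n
    unfolding chf_def
  proof (rule integral_cong_AE)
    show "AE w in M. turn (u (r n) * of_int (Y w)) = turn (s n * of_int (Y w))"
      using AE0
    proof (eventually_elim)
      case (elim w)
      have "turn (u (r n) * of_int (Y w)) = turn (s n * of_int (Y w)) * turn (t0 * of_int (Y w))"
        unfolding turn_add[symmetric] by (simp add: s_def algebra_simps)
      then show ?case using elim by simp
    qed
  qed auto
  have s_bd: "norm (chf M Y (s n) - 1) < 1 / real (Suc (r n)) * (of_int D * \<bar>s n\<bar>)" for n
  proof -
    have "1 / real (Suc (r n)) * int_dist (of_int D * u (r n)) \<le> 1 / real (Suc (r n)) * (of_int D * \<bar>s n\<bar>)"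
      by (intro mult_left_mono dist_s) auto
    with u[of "r n"] have "norm (1 - chf M Y (s n)) < 1 / real (Suc (r n)) * (of_int D * \<bar>s n\<bar>)"
      unfolding chf_s by linarith
    then show ?thesis by (simp only: norm_minus_commute)
  qed
  have s_nz: "s n \<noteq> 0" for n
  proof
    assume "s n = 0"
    with s_bd[of n] have "norm (chf M Y (s n) - 1) < 0" by (simp only: abs_zero mult_zero_right)
    then show False by simp
  qed
  have quot_bd: "norm ((chf M Y (s n) - 1) / of_real (s n)) \<le> of_int D * (1 / real (Suc (r n)))" for n
  proof -
    have "norm (chf M Y (s n) - 1) \<le> of_int D * (1 / real (Suc (r n))) * \<bar>s n\<bar>"
      using less_imp_le[OF s_bd[of n]] by (simp only: mult_ac)
    moreover have "0 < \<bar>s n\<bar>" using s_nz[of n] by simp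
    ultimately have "norm (chf M Y (s n) - 1) / \<bar>s n\<bar> \<le> of_int D * (1 / real (Suc (r n)))"
      by (simp only: pos_divide_le_eq)
    then show ?thesis by (simp only: norm_divide norm_of_real)
  qed
  have "(\<lambda>n. of_int D * (1 / real (Suc (r n)))) \<longlonglongrightarrow> 0"
    by (rule tendsto_mult_right_zero[OF inv])
  then have "(\<lambda>n. (chf M Y (s n) - 1) / of_real (s n)) \<longlonglongrightarrow> 0"
    by (rule Lim_null_comparison[OF always_eventually[OF allI[OF quot_bd]]])
  from LIMSEQ_unique[OF tendsto_chf_quotient[OF int s0 s_nz] this]
  have "complex_of_real (2 * pi * (\<integral>w. real_of_int (Y w) \<partial>M)) = 0" by simp
  then show False using mean unfolding of_real_eq_0_iff by simp
qed

end

lemma integral_turn_walk: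
  fixes X :: "nat \<Rightarrow> 'a \<Rightarrow> int"
  assumes ind: "indep_vars (\<lambda>_. count_space UNIV) X {1..}"
    and id: "\<And>j. j \<ge> 1 \<Longrightarrow> distr M (count_space UNIV) (X j) = distr M (count_space UNIV) (X 1)"
  shows "(\<integral>w. turn (t * of_int (walk X k w)) \<partial>M) = chf M (X 1) t ^ k"
proof -
  have Xm [measurable]: "X j \<in> measurable M (count_space UNIV)" if "1 \<le> j" for j
    using ind that by (auto simp: indep_vars_def2)
  have chf_char: "char (distr M borel (\<lambda>w. real_of_int (X j w))) (2 * pi * t) = chf M (X 1) t" if j: "1 \<le> j" for j
  proof -
    note [measurable] = Xm[OF j] Xm[of 1]
    have "char (distr M borel (\<lambda>w. real_of_int (X j w))) (2 * pi * t) = (\<integral>w. turn (t * of_int (X j w)) \<partial>M)"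
      unfolding char_def by (subst integral_distr) (auto simp: turn_def cis_conv_exp mult_ac)
    also have "\<dots> = (\<integral>x. turn (t * of_int x) \<partial>distr M (count_space UNIV) (X j))"
      by (subst integral_distr) auto
    also have "\<dots> = (\<integral>x. turn (t * of_int x) \<partial>distr M (count_space UNIV) (X 1))"
      using id[OF j] by simp
    also have "\<dots> = chf M (X 1) t" unfolding chf_def by (subst integral_distr) auto
    finally show ?thesis .
  qed
  have "indep_vars (\<lambda>_. borel) (\<lambda>j w. real_of_int (X j w)) {1..k}"
    by (rule indep_vars_compose2[OF indep_vars_subset[OF ind]]) auto
  from char_distr_sum[OF this, of "2 * pi * t"]
  have "char (distr M borel (\<lambda>w. \<Sum>j\<in>{1..k}. real_of_int (X j w))) (2 * pi * t) = chf M (X 1) t ^ k"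
    by (simp add: chf_char)
  moreover have "char (distr M borel (\<lambda>w. \<Sum>j\<in>{1..k}. real_of_int (X j w))) (2 * pi * t) =
     (\<integral>w. turn (t * of_int (walk X k w)) \<partial>M)"
    unfolding char_def walk_def
    by (subst integral_distr) (auto simp: turn_def cis_conv_exp mult_ac intro!: borel_measurable_sum)
  ultimately show ?thesis by simp
qed

end

section \<open>Periodic functions of bounded variation\<close>

text \<open>
  \<open>V y\<close> is the total variation on \<open>[a, y]\<close>. Appending the two points \<open>x \<le> y\<close> to a partition of
  \<open>[a, x]\<close> shows that \<open>V\<close> grows by at least \<open>\<bar>f y - f x\<bar>\<close> from \<open>x\<close> to \<open>y\<close>, which is the monotonicity
  of \<open>V\<close> and of \<open>V - f\<close> at once.
\<close>

lemma jordan_decomposition: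
  assumes "bounded_var_on a b f"
  obtains V where "mono_on {a..b} V" "mono_on {a..b} (\<lambda>x. V x - f x)"
proof -
  define var where "var n x = (\<Sum>i<n. \<bar>f (x (Suc i)) - f (x i)\<bar>)" for n and x :: "nat \<Rightarrow> real"
  define P where "P y = {(n, x) | (n::nat) x. mono_on {..n} x \<and> x ` {..n} \<subseteq> {a..y}}" for y :: real
  obtain B where B: "\<And>n x. mono_on {..n} x \<Longrightarrow> x ` {..n} \<subseteq> {a..b} \<Longrightarrow> var n x \<le> B"
    using assms unfolding bounded_var_on_def var_def by blast
  define V where "V y = (SUP (n, x) \<in> P y. var n x)" for y
  have bdd: "bdd_above ((\<lambda>(n, x). var n x) ` P y)" if "y \<le> b" for y
    by (rule bdd_aboveI2[where M = B]) (use that in \<open>force simp: P_def intro!: B\<close>)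
  have ne: "P y \<noteq> {}" if "a \<le> y" for y
  proof -
    have "(0, \<lambda>_. a) \<in> P y" using that by (auto simp: P_def mono_on_def)
    then show ?thesis by blast
  qed
  have step: "V x + \<bar>f y - f x\<bar> \<le> V y" if xy: "a \<le> x" "x \<le> y" "y \<le> b" for x y
  proof -
    have "V x \<le> V y - \<bar>f y - f x\<bar>"
      unfolding V_def[of x]
    proof (rule cSUP_least[OF ne[OF xy(1)]])
      fix nz assume "nz \<in> P x"
      then obtain n z where nz: "nz = (n, z)" "mono_on {..n} z" "z ` {..n} \<subseteq> {a..x}"
        by (auto simp: P_def)
      define z' where "z' i = (if i \<le> n then z i else if i = Suc n then x else y)" for i
      have zx: "a \<le> z i \<and> z i \<le> x" if "i \<le> n" for i using nz(3) that by force
      have "mono_on {..Suc (Suc n)} z'"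
      proof (rule mono_onI)
        fix i j assume ij: "i \<in> {..Suc (Suc n)}" "j \<in> {..Suc (Suc n)}" "i \<le> j"
        show "z' i \<le> z' j"
        proof (cases "j \<le> n")
          case True
          then show ?thesis using ij mono_onD[OF nz(2), of i j] by (simp add: z'_def)
        next
          case False
          then show ?thesis using ij xy zx[of i] unfolding z'_def by (cases "i \<le> n") auto
        qed
      qed
      moreover have "z' i \<in> {a..y}" for i
        using zx[of i] xy by (auto simp: z'_def)
      ultimately have "(Suc (Suc n), z') \<in> P y" by (auto simp: P_def)
      then have "var (Suc (Suc n)) z' \<le> V y"
        unfolding V_def by (rule cSUP_upper2[OF bdd[OF xy(3)]]) simp
      moreover have "var (Suc (Suc n)) z' = var n z + \<bar>f x - f (z n)\<bar> + \<bar>f y - f x\<bar>"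
        unfolding var_def z'_def by simp
      ultimately show "(case nz of (n, x) \<Rightarrow> var n x) \<le> V y - \<bar>f y - f x\<bar>" by (simp add: nz(1))
    qed
    then show ?thesis by simp
  qed
  show thesis
  proof (rule that)
    show "mono_on {a..b} V"
    proof (rule mono_onI)
      fix r s assume "r \<in> {a..b}" "s \<in> {a..b}" "r \<le> s"
      then show "V r \<le> V s" using step[of r s] by auto
    qed
    show "mono_on {a..b} (\<lambda>x. V x - f x)"
    proof (rule mono_onI)
      fix r s assume "r \<in> {a..b}" "s \<in> {a..b}" "r \<le> s"
      then show "V r - f r \<le> V s - f s" using step[of r s] by auto
    qed
  qed
qed

lemma periodic_add_int:
  assumes "\<And>x::real. f (x + 1) = f x"
  shows "f (x + of_int n) = f x"
proof -
  have nat: "f (y + of_nat k) = f y" for y k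
  proof (induction k)
    case (Suc k)
    show ?case using assms[of "y + of_nat k"] Suc by (simp add: add_ac)
  qed simp
  show ?thesis
  proof (cases "0 \<le> n")
    case True
    then show ?thesis using nat[of x "nat n"] by simp
  next
    case False
    then show ?thesis using nat[of "x + of_int n" "nat (- n)"] by simp
  qed
qed

lemma periodic_bv_frac:
  assumes "f \<in> periodic_bv"
  shows "f x = f (frac x)"
  using periodic_add_int[of f "frac x" "\<lfloor>x\<rfloor>"] assms by (simp add: periodic_bv_def frac_def)

text \<open>
  The monotone parts on \<open>[0, 1]\<close>, extended by constants to the whole line. Measurability and the
  countability of the discontinuities are inherited from monotone functions through this form.
\<close>

lemma periodic_bv_mono_parts:
  assumes "f \<in> periodic_bv"
  obtains V G where "mono V" "mono G" "\<And>x. f x = V (frac x) - G (frac x)"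
proof -
  obtain V where V: "mono_on {0..1} V" "mono_on {0..1} (\<lambda>x. V x - f x)"
    using jordan_decomposition[of 0 1 f] assms by (auto simp: periodic_bv_def)
  define clamp where "clamp x = max 0 (min 1 x)" for x :: real
  have cl: "clamp x \<in> {0..1}" "x \<le> y \<Longrightarrow> clamp x \<le> clamp y" for x y by (auto simp: clamp_def)
  show thesis
  proof (rule that[of "\<lambda>x. V (clamp x)" "\<lambda>x. V (clamp x) - f (clamp x)"])
    show "mono (\<lambda>x. V (clamp x))"
      by (intro monoI mono_onD[OF V(1)] cl)
    show "mono (\<lambda>x. V (clamp x) - f (clamp x))"
      by (intro monoI mono_onD[OF V(2)] cl)
    fix x
    have "clamp (frac x) = frac x" using frac_lt_1[of x] frac_ge_0[of x] by (simp add: clamp_def)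
    then show "f x = V (clamp (frac x)) - (V (clamp (frac x)) - f (clamp (frac x)))"
      using periodic_bv_frac[OF assms, of x] by simp
  qed
qed

lemma periodic_bv_measurable:
  assumes "f \<in> periodic_bv"
  shows "f \<in> borel_measurable borel"
proof -
  obtain V G where VG: "mono V" "mono G" "\<And>x. f x = V (frac x) - G (frac x)"
    by (rule periodic_bv_mono_parts[OF assms]) blast
  have [measurable]: "V \<in> borel_measurable borel" "G \<in> borel_measurable borel"
    using VG by (auto intro: borel_measurable_mono)
  have "(\<lambda>x. V (x - of_int \<lfloor>x\<rfloor>) - G (x - of_int \<lfloor>x\<rfloor>)) \<in> borel_measurable borel" by measurable
  also have "(\<lambda>x. V (x - of_int \<lfloor>x\<rfloor>) - G (x - of_int \<lfloor>x\<rfloor>)) = f" by (auto simp: VG(3) frac_def)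
  finally show ?thesis .
qed

lemma periodic_bv_countable_discontinuities:
  assumes "f \<in> periodic_bv"
  shows "countable {x. \<not> isCont f x}"
proof -
  obtain V G where VG: "mono V" "mono G" "\<And>x. f x = V (frac x) - G (frac x)"
    by (rule periodic_bv_mono_parts[OF assms]) blast
  \<comment> \<open>The point 0 is included because the fractional part jumps at the integers.\<close>
  define E where "E = insert 0 ({y. \<not> isCont V y} \<union> {y. \<not> isCont G y})"
  have "countable E" unfolding E_def using VG by (auto intro: mono_ctble_discont)
  then have "countable (\<Union>n::int. (\<lambda>y. y + of_int n) ` E)" by auto
  moreover have "{x. \<not> isCont f x} \<subseteq> (\<Union>n::int. (\<lambda>y. y + of_int n) ` E)"
  proof (rule subsetI, rule ccontr)
    fix x assume x: "x \<in> {x. \<not> isCont f x}" "x \<notin> (\<Union>n::int. (\<lambda>y. y + of_int n) ` E)"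
    have "x - of_int \<lfloor>x\<rfloor> \<notin> E"
    proof
      assume "x - of_int \<lfloor>x\<rfloor> \<in> E"
      then have "(x - of_int \<lfloor>x\<rfloor>) + of_int \<lfloor>x\<rfloor> \<in> (\<lambda>y. y + of_int \<lfloor>x\<rfloor>) ` E" by (rule imageI)
      with x(2) show False by auto
    qed
    then have c: "isCont V (x - of_int \<lfloor>x\<rfloor>)" "isCont G (x - of_int \<lfloor>x\<rfloor>)" "x - of_int \<lfloor>x\<rfloor> \<noteq> 0"
      by (auto simp: E_def)
    have "isCont (\<lambda>z. V (z - of_int \<lfloor>x\<rfloor>) - G (z - of_int \<lfloor>x\<rfloor>)) x"
    proof (rule continuous_diff)
      have shift: "isCont (\<lambda>z. z - of_int \<lfloor>x\<rfloor> :: real) x" by simp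
      show "isCont (\<lambda>z. V (z - of_int \<lfloor>x\<rfloor>)) x" "isCont (\<lambda>z. G (z - of_int \<lfloor>x\<rfloor>)) x"
        by (rule isCont_o2[OF shift c(1)], rule isCont_o2[OF shift c(2)])
    qed
    moreover have "eventually (\<lambda>z. f z = V (z - of_int \<lfloor>x\<rfloor>) - G (z - of_int \<lfloor>x\<rfloor>)) (nhds x)"
    proof -
      have "of_int \<lfloor>x\<rfloor> < x" "x < of_int \<lfloor>x\<rfloor> + 1" using c(3) of_int_floor_le[of x] by linarith+
      then have "eventually (\<lambda>z. z \<in> {of_int \<lfloor>x\<rfloor><..<of_int \<lfloor>x\<rfloor> + 1}) (nhds x)"
        by (intro eventually_nhds_in_open) auto
      then show ?thesis
      proof eventually_elim
        case (elim z)
        then have "\<lfloor>z\<rfloor> = \<lfloor>x\<rfloor>" by (intro floor_unique) auto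
        then show ?case by (simp add: VG(3) frac_def)
      qed
    qed
    ultimately have "isCont f x" by (simp add: isCont_cong)
    with x(1) show False by simp
  qed
  ultimately show ?thesis by (rule countable_subset[rotated])
qed

lemma periodic_bv_cyclic_variation:
  assumes "f \<in> periodic_bv"
  obtains B where "0 \<le> B"
    "\<And>q. 1 \<le> q \<Longrightarrow> (\<Sum>a<q. \<bar>f (real (Suc a) / real q) - f (real a / real q)\<bar>) \<le> B"
proof -
  obtain B where B: "\<And>n x. mono_on {..n} x \<and> x ` {..n} \<subseteq> {0..1} \<Longrightarrow>
      (\<Sum>i<n. \<bar>f (x (Suc i)) - f (x i)\<bar>) \<le> B"
    using assms unfolding periodic_bv_def bounded_var_on_def by blast
  show thesis
  proof (rule that[of B])
    show "0 \<le> B" using B[of 0 "\<lambda>_. 0"] by (auto simp: mono_on_def)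
    show "(\<Sum>a<q. \<bar>f (real (Suc a) / real q) - f (real a / real q)\<bar>) \<le> B" if "1 \<le> q" for q
      by (rule B) (use that in \<open>auto simp: mono_on_def divide_right_mono\<close>)
  qed
qed

lemma periodic_bv_bounded:
  assumes "f \<in> periodic_bv"
  obtains B where "\<And>x. \<bar>f x\<bar> \<le> B"
proof -
  obtain B where B: "\<And>n x. mono_on {..n} x \<and> x ` {..n} \<subseteq> {0..1} \<Longrightarrow>
      (\<Sum>i<n. \<bar>f (x (Suc i)) - f (x i)\<bar>) \<le> B"
    using assms unfolding periodic_bv_def bounded_var_on_def by blast
  show thesis
  proof (rule that)
    fix x
    have "\<bar>f (frac x) - f 0\<bar> \<le> B"
      using B[of 1 "\<lambda>i. if i = 0 then 0 else frac x"]
      by (simp add: mono_on_def image_subset_iff less_imp_le[OF frac_lt_1])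
    then show "\<bar>f x\<bar> \<le> \<bar>f 0\<bar> + B" using periodic_bv_frac[OF assms, of x] by linarith
  qed
qed

section \<open>Averages over the rational grid\<close>

lemma prob_space_circle_unif: "prob_space circle_unif"
  unfolding circle_unif_def by (rule prob_space_uniform_measure) auto

lemma sets_circle_unif [measurable_cong]: "sets circle_unif = sets borel"
  by (simp add: circle_unif_def uniform_measure_def)

lemma space_circle_unif [simp]: "space circle_unif = UNIV"
  by (simp add: circle_unif_def uniform_measure_def)

lemma AE_circle_unif_notin_countable:
  assumes "countable E"
  shows "AE u in circle_unif. u \<notin> E"
  unfolding circle_unif_def
  by (rule AE_uniform_measureI)
    (use AE_not_in[OF countable_imp_null_set_lborel[OF assms]] in \<open>auto elim: eventually_mono\<close>)

lemma AE_circle_unif_mem: "AE u in circle_unif. u \<in> {0..<1}"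
  unfolding circle_unif_def by (rule AE_uniform_measureI) auto

lemma integral_circle_unif:
  fixes f :: "real \<Rightarrow> real"
  assumes [measurable]: "f \<in> borel_measurable borel"
  shows "(\<integral>u. f u \<partial>circle_unif) = (LINT t:{0..1}|lborel. f t)"
proof -
  have eq: "circle_unif = density lborel (\<lambda>x. ennreal (indicator {0..<1} x))"
    unfolding circle_unif_def uniform_measure_def
    by (intro density_cong) (auto simp: indicator_def)
  have "(\<integral>u. f u \<partial>circle_unif) = (LINT t|lborel. indicator {0..<1} t *\<^sub>R f t)"
    unfolding eq by (subst integral_density) auto
  also have "\<dots> = (LINT t|lborel. indicator {0..1} t *\<^sub>R f t)"
  proof (rule integral_cong_AE)
    show "AE t in lborel. indicator {0..<1} t *\<^sub>R f t = indicator {0..1} t *\<^sub>R f t"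
      using AE_lborel_singleton[of 1] by eventually_elim (auto simp: indicator_def)
  qed auto
  finally show ?thesis by (simp add: set_lebesgue_integral_def)
qed

lemma floor_mult_eq_iff:
  assumes "1 \<le> (q::nat)"
  shows "\<lfloor>real q * u\<rfloor> = int a \<longleftrightarrow> u \<in> {real a / real q..<real (Suc a) / real q}"
proof -
  have "\<lfloor>real q * u\<rfloor> = int a \<longleftrightarrow> real a \<le> real q * u \<and> real q * u < real a + 1"
    by (simp add: floor_eq_iff)
  also have "\<dots> \<longleftrightarrow> u \<in> {real a / real q..<real (Suc a) / real q}"
    using assms by (auto simp: field_simps)
  finally show ?thesis .
qed

lemma measurable_floor_grid [measurable]:
  "(\<lambda>u. H (of_int \<lfloor>real q * u\<rfloor> / real q)) \<in> borel_measurable borel"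
proof -
  have "(\<lambda>u::real. \<lfloor>real q * u\<rfloor>) \<in> measurable borel (count_space UNIV)" by measurable
  from measurable_compose[OF this, of "\<lambda>i. H (of_int i / real q)"] show ?thesis by simp
qed

text \<open>
  Rounding a uniform point of the circle down to a multiple of \<open>1 / q\<close> gives a uniform point of the grid.
\<close>

lemma integral_circle_unif_floor:
  fixes H :: "real \<Rightarrow> 'b::{banach, second_countable_topology}"
  assumes q: "1 \<le> (q::nat)"
  shows "(\<integral>u. H (of_int \<lfloor>real q * u\<rfloor> / real q) \<partial>circle_unif) = (\<Sum>a<q. H (real a / real q)) /\<^sub>R real q"
proof -
  interpret circle: prob_space circle_unif by (rule prob_space_circle_unif)
  define I where "I a = {real a / real q..<real (Suc a) / real q}" for a
  have I [measurable]: "I a \<in> sets borel" for a by (simp add: I_def)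
  have "(\<integral>u. H (of_int \<lfloor>real q * u\<rfloor> / real q) \<partial>circle_unif)
      = (\<integral>u. (\<Sum>a<q. indicator (I a) u *\<^sub>R H (real a / real q)) \<partial>circle_unif)"
  proof (rule integral_cong_AE)
    show "AE u in circle_unif. H (of_int \<lfloor>real q * u\<rfloor> / real q) = (\<Sum>a<q. indicator (I a) u *\<^sub>R H (real a / real q))"
      using AE_circle_unif_mem
    proof eventually_elim
      case (elim u)
      define b where "b = nat \<lfloor>real q * u\<rfloor>"
      have u: "0 \<le> real q * u" "real q * u < real q" using elim q by auto
      have b: "\<lfloor>real q * u\<rfloor> = int b" using u(1) unfolding b_def by (subst int_nat_eq) simp
      have "real b \<le> real q * u" using b of_int_floor_le[of "real q * u"] by simp
      then have bq: "b < q" using u(2) by linarith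
      have "indicator (I a) u = (if a = b then 1 else 0 :: real)" for a
        using floor_mult_eq_iff[OF q, of u a] b by (auto simp: I_def indicator_def)
      then have "(\<Sum>a<q. indicator (I a) u *\<^sub>R H (real a / real q)) = (\<Sum>a<q. if a = b then H (real a / real q) else 0)"
        by (intro sum.cong) auto
      also have "\<dots> = H (of_int \<lfloor>real q * u\<rfloor> / real q)" using bq b by simp
      finally show ?case by simp
    qed
    show "(\<lambda>u. H (of_int \<lfloor>real q * u\<rfloor> / real q)) \<in> borel_measurable circle_unif"
      by measurable
    show "(\<lambda>u. \<Sum>a<q. indicator (I a) u *\<^sub>R H (real a / real q)) \<in> borel_measurable circle_unif"
      by measurable
  qed
  also have "\<dots> = (\<Sum>a<q. \<integral>u. indicator (I a) u *\<^sub>R H (real a / real q) \<partial>circle_unif)"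
    by (rule Bochner_Integration.integral_sum) (auto intro!: integrable_scaleR_left circle.integrable_const_bound[where B = 1])
  also have "\<dots> = (\<Sum>a<q. (1 / real q) *\<^sub>R H (real a / real q))"
  proof (rule sum.cong[OF refl])
    fix a assume "a \<in> {..<q}"
    then have "{0..<1} \<inter> I a = I a"
      using q by (auto simp: I_def intro: less_le_trans order_trans[rotated])
    moreover have "measure lborel (I a) = 1 / real q"
      using q by (simp add: I_def divide_right_mono diff_divide_distrib[symmetric])
    ultimately have "measure circle_unif (I a) = 1 / real q"
      unfolding circle_unif_def by (subst measure_uniform_measure) auto
    then show "(\<integral>u. indicator (I a) u *\<^sub>R H (real a / real q) \<partial>circle_unif) = (1 / real q) *\<^sub>R H (real a / real q)"
      by (subst integral_scaleR_left) (auto intro!: circle.integrable_const_bound[where B = 1])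
  qed
  finally show ?thesis by (simp add: scaleR_sum_right inverse_eq_divide)
qed

text \<open>
  A Riemann sum in which the integrand may vary with \<open>n\<close>. Read as an integral of a step function,
  it converges by dominated convergence, and only almost every point has to be a point of continuous
  convergence; this suits products of translates of functions of bounded variation.
\<close>

lemma tendsto_grid_average:
  fixes H :: "nat \<Rightarrow> real \<Rightarrow> 'b::{banach, second_countable_topology}"
  assumes q: "filterlim q at_top sequentially" "\<And>n. 1 \<le> q n"
    and bound: "\<And>n x. norm (H n x) \<le> B"
    and [measurable]: "H0 \<in> borel_measurable borel"
    and lim: "AE u in circle_unif. \<forall>v. v \<longlonglongrightarrow> u \<longrightarrow> (\<lambda>n. H n (v n)) \<longlonglongrightarrow> H0 u"
  shows "(\<lambda>n. (\<Sum>a<q n. H n (real a / real (q n))) /\<^sub>R real (q n)) \<longlonglongrightarrow> (\<integral>u. H0 u \<partial>circle_unif)"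
proof -
  interpret circle: prob_space circle_unif by (rule prob_space_circle_unif)
  have "(\<lambda>n. \<integral>u. H n (of_int \<lfloor>real (q n) * u\<rfloor> / real (q n)) \<partial>circle_unif) \<longlonglongrightarrow> (\<integral>u. H0 u \<partial>circle_unif)"
  proof (rule integral_dominated_convergence[where w = "\<lambda>_. B"])
    show "AE u in circle_unif. (\<lambda>n. H n (of_int \<lfloor>real (q n) * u\<rfloor> / real (q n))) \<longlonglongrightarrow> H0 u"
      using lim
    proof eventually_elim
      case (elim u)
      have "(\<lambda>n. of_int \<lfloor>real (q n) * u\<rfloor> / real (q n)) \<longlonglongrightarrow> u"
      proof (rule tendsto_sandwich)
        have inv: "(\<lambda>n. 1 / real (q n)) \<longlonglongrightarrow> 0"
          using filterlim_compose[OF lim_1_over_n q(1)] by simp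
        show "(\<lambda>n. u - 1 / real (q n)) \<longlonglongrightarrow> u" using tendsto_diff[OF tendsto_const inv, of u] by simp
        show "(\<lambda>n. u) \<longlonglongrightarrow> u" by simp
        show "\<forall>\<^sub>F n in sequentially. u - 1 / real (q n) \<le> of_int \<lfloor>real (q n) * u\<rfloor> / real (q n)"
        proof (intro always_eventually allI)
          fix n
          have pos: "0 < real (q n)" using q(2)[of n] by simp
          then have "(u - 1 / real (q n)) * real (q n) = real (q n) * u - 1" by (simp add: field_simps)
          also have "\<dots> \<le> of_int \<lfloor>real (q n) * u\<rfloor>" by linarith
          finally show "u - 1 / real (q n) \<le> of_int \<lfloor>real (q n) * u\<rfloor> / real (q n)"
            using pos by (simp only: pos_le_divide_eq)
        qed
        show "\<forall>\<^sub>F n in sequentially. of_int \<lfloor>real (q n) * u\<rfloor> / real (q n) \<le> u"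
        proof (intro always_eventually allI)
          fix n
          have "0 < real (q n)" using q(2)[of n] by simp
          moreover have "of_int \<lfloor>real (q n) * u\<rfloor> \<le> real (q n) * u" by linarith
          ultimately show "of_int \<lfloor>real (q n) * u\<rfloor> / real (q n) \<le> u"
            by (simp add: field_simps)
        qed
      qed
      with elim show ?case by blast
    qed
  qed (use bound in auto)
  then show ?thesis by (simp only: integral_circle_unif_floor[OF q(2)])
qed

section \<open>The finite Fourier transform\<close>

definition dft :: "nat \<Rightarrow> (real \<Rightarrow> real) \<Rightarrow> int \<Rightarrow> complex" where
  "dft q g h = (\<Sum>a<q. of_real (g (real a / real q)) * turn (- (of_int h * (real a / real q)))) / of_nat q"

text \<open>
  Representatives modulo \<open>q\<close> centred at \<open>0\<close>: with this choice a fixed integer \<open>h\<close> is a valid frequency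
  for all large \<open>q\<close>, and the decay in \<open>h\<close> is uniform in \<open>q\<close>.
\<close>

definition balanced_residues :: "nat \<Rightarrow> int set" where
  "balanced_residues q = {h. - int q < 2 * h \<and> 2 * h \<le> int q}"

lemma balanced_residues_eq:
  assumes "1 \<le> q"
  shows "balanced_residues q = (\<lambda>j. int j - int ((q - 1) div 2)) ` {..<q}"
proof (intro equalityI subsetI)
  fix h assume "h \<in> balanced_residues q"
  then have "- int q < 2 * h" "2 * h \<le> int q" by (auto simp: balanced_residues_def)
  then have "0 \<le> h + int ((q - 1) div 2)" "h + int ((q - 1) div 2) < int q" using assms by linarith+
  then have "h = int (nat (h + int ((q - 1) div 2))) - int ((q - 1) div 2)"
     "nat (h + int ((q - 1) div 2)) \<in> {..<q}" by auto
  then show "h \<in> (\<lambda>j. int j - int ((q - 1) div 2)) ` {..<q}" by blast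
next
  fix h assume "h \<in> (\<lambda>j. int j - int ((q - 1) div 2)) ` {..<q}"
  then obtain j where "j < q" "h = int j - int ((q - 1) div 2)" by auto
  then show "h \<in> balanced_residues q" using assms by (simp add: balanced_residues_def) linarith
qed

lemma finite_residues [simp]: "finite (balanced_residues q)"
  by (rule finite_subset[of _ "{- int q..int q}"]) (auto simp: balanced_residues_def)

lemma abs_le_of_residues: "h \<in> balanced_residues q \<Longrightarrow> 2 * \<bar>h\<bar> \<le> int q"
  by (auto simp: balanced_residues_def)

text \<open>
  The representatives are \<open>q\<close> consecutive integers, so that this is a geometric sum of a \<open>q\<close>-th root of
  unity.
\<close>

lemma sum_turn_residues:
  assumes q: "1 \<le> q"
  shows "(\<Sum>h\<in>balanced_residues q. turn (of_int (h * m) / real q)) = (if int q dvd m then of_nat q else 0)"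
proof -
  define z where "z = turn (of_int m / real q)"
  define l where "l = int ((q - 1) div 2)"
  have zq: "z ^ q = 1" unfolding z_def turn_power using q by (simp add: turn_eq_1_iff)
  have z1: "z = 1 \<longleftrightarrow> int q dvd m"
  proof
    assume "z = 1"
    then obtain k :: int where "of_int m / real q = of_int k" unfolding z_def turn_eq_1_iff by (elim Ints_cases)
    then have "of_int m = (of_int (k * int q) :: real)" using q by (simp add: field_simps)
    then have "m = k * int q" by (simp only: of_int_eq_iff)
    then show "int q dvd m" by simp
  next
    assume "int q dvd m"
    then obtain k where "m = int q * k" by (elim dvdE)
    then have "of_int m / real q = of_int k" using q by simp
    then show "z = 1" unfolding z_def turn_eq_1_iff by simp
  qed
  have "(\<Sum>h\<in>balanced_residues q. turn (of_int (h * m) / real q)) = (\<Sum>j<q. turn (of_int ((int j - l) * m) / real q))"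
    unfolding balanced_residues_eq[OF q] l_def[symmetric]
    by (subst sum.reindex) (auto simp: inj_on_def)
  also have "\<dots> = (\<Sum>j<q. turn (- (of_int (l * m) / real q)) * z ^ j)"
    unfolding z_def turn_power turn_add[symmetric]
    by (intro sum.cong arg_cong[where f = turn]) (auto simp: diff_divide_distrib algebra_simps)
  also have "\<dots> = turn (- (of_int (l * m) / real q)) * (\<Sum>j<q. z ^ j)"
    by (simp add: sum_distrib_left)
  also have "\<dots> = (if int q dvd m then of_nat q else 0)"
  proof (cases "z = 1")
    case True
    then obtain k where "m = int q * k" using z1 by (auto elim: dvdE)
    then have "- (of_int (l * m) / real q) = of_int (- (l * k))" using q by simp
    then have "turn (- (of_int (l * m) / real q)) = 1" by (simp only: turn_eq_1_iff Ints_of_int)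
    then show ?thesis using True z1 by simp
  next
    case False
    have "(\<Sum>j<q. z ^ j) = 0" using sum_gp_strict[of z q] False zq by simp
    then show ?thesis using False z1 by simp
  qed
  finally show ?thesis .
qed

text \<open>
  Expand the squared modulus into a double sum over grid points \<open>a\<close> and \<open>b\<close>. By orthogonality the sum over
  \<open>h\<close> keeps only the pairs with \<open>b\<close> congruent to \<open>a + m\<close>, and periodicity of \<open>g\<close> identifies
  \<open>g (b / q)\<close> with the translate.
\<close>

lemma dft_parseval:
  assumes q: "1 \<le> q" and per: "\<And>x. g (x + 1) = g x"
  shows "of_real ((\<Sum>a<q. g (real a / real q) * g (real a / real q + of_int m / real q)) / real q)
    = (\<Sum>h\<in>balanced_residues q. of_real ((norm (dft q g h))\<^sup>2) * turn (of_int h * (of_int m / real q)))"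
proof -
  define c where "c a = complex_of_real (g (real a / real q))" for a
  have normsq: "of_real ((norm (dft q g h))\<^sup>2) * turn (of_int h * (of_int m / real q))
      = (\<Sum>a<q. \<Sum>b<q. c a * c b * turn (of_int (h * (int a - int b + m)) / real q)) / (of_nat q)\<^sup>2" for h
  proof -
    have conj: "cnj (dft q g h) = (\<Sum>a<q. c a * turn (of_int h * (real a / real q))) / of_nat q"
      by (simp add: dft_def c_def turn_minus)
    have dft: "dft q g h = (\<Sum>b<q. c b * turn (- (of_int h * (real b / real q)))) / of_nat q"
      by (simp add: dft_def c_def)
    have "of_real ((norm (dft q g h))\<^sup>2) * turn (of_int h * (of_int m / real q))
        = cnj (dft q g h) * dft q g h * turn (of_int h * (of_int m / real q))"
      by (simp add: complex_norm_square[symmetric] mult.commute)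
    also have "\<dots> = (\<Sum>a<q. c a * turn (of_int h * (real a / real q))) / of_nat q *
        ((\<Sum>b<q. c b * turn (- (of_int h * (real b / real q)))) / of_nat q) * turn (of_int h * (of_int m / real q))"
      by (rule arg_cong2[where f = "\<lambda>x y. x * y * turn (of_int h * (of_int m / real q))", OF conj dft])
    also have "(\<Sum>a<q. c a * turn (of_int h * (real a / real q))) / of_nat q *
        ((\<Sum>b<q. c b * turn (- (of_int h * (real b / real q)))) / of_nat q) * turn (of_int h * (of_int m / real q))
      = (\<Sum>a<q. \<Sum>b<q. (c a * turn (of_int h * (real a / real q))) * (c b * turn (- (of_int h * (real b / real q)))) *
          turn (of_int h * (of_int m / real q))) / (of_nat q)\<^sup>2"
    proof -
      have "(\<Sum>a<q. \<Sum>b<q. (c a * turn (of_int h * (real a / real q))) * (c b * turn (- (of_int h * (real b / real q)))) *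
          turn (of_int h * (of_int m / real q)))
        = (\<Sum>a<q. c a * turn (of_int h * (real a / real q))) * (\<Sum>b<q. c b * turn (- (of_int h * (real b / real q)))) *
          turn (of_int h * (of_int m / real q))"
        by (subst sum_product) (simp only: sum_distrib_right)
      then show ?thesis by (simp add: power2_eq_square)
    qed
    also have "\<dots> = (\<Sum>a<q. \<Sum>b<q. c a * c b * turn (of_int (h * (int a - int b + m)) / real q)) / (of_nat q)\<^sup>2"
    proof -
      have "turn (of_int h * (real a / real q)) * turn (- (of_int h * (real b / real q))) * turn (of_int h * (of_int m / real q))
          = turn (of_int (h * (int a - int b + m)) / real q)" for a b
        unfolding turn_add[symmetric]
        by (rule arg_cong[where f = turn]) (simp add: diff_divide_distrib add_divide_distrib algebra_simps)
      then have "(c a * turn (of_int h * (real a / real q))) * (c b * turn (- (of_int h * (real b / real q)))) *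
          turn (of_int h * (of_int m / real q)) = c a * c b * turn (of_int (h * (int a - int b + m)) / real q)" for a b
        by (metis (no_types, lifting) mult.assoc mult.left_commute)
      then show ?thesis by (simp only:)
    qed
    finally show ?thesis .
  qed
  have "(\<Sum>h\<in>balanced_residues q. of_real ((norm (dft q g h))\<^sup>2) * turn (of_int h * (of_int m / real q)))
     = (\<Sum>h\<in>balanced_residues q. \<Sum>a<q. \<Sum>b<q. c a * c b * turn (of_int (h * (int a - int b + m)) / real q)) / (of_nat q)\<^sup>2"
    by (simp only: normsq sum_divide_distrib)
  also have "(\<Sum>h\<in>balanced_residues q. \<Sum>a<q. \<Sum>b<q. c a * c b * turn (of_int (h * (int a - int b + m)) / real q))
     = (\<Sum>a<q. \<Sum>b<q. c a * c b * (\<Sum>h\<in>balanced_residues q. turn (of_int (h * (int a - int b + m)) / real q)))"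
    unfolding sum_distrib_left
    by (subst sum.swap, rule sum.cong[OF refl], rule sum.swap)
  also have "\<dots> = (\<Sum>a<q. c a * of_real (g (real a / real q + of_int m / real q)) * of_nat q)"
  proof (rule sum.cong[OF refl])
    fix a assume "a \<in> {..<q}"
    \<comment> \<open>The only grid index congruent to \<open>a + m\<close>.\<close>
    define b0 where "b0 = nat ((int a + m) mod int q)"
    have b0: "int b0 = (int a + m) mod int q" "b0 < q"
      using q by (auto simp: b0_def nat_less_iff)
    have dvd: "int q dvd int a - int b + m \<longleftrightarrow> b = b0" if "b < q" for b
    proof -
      have "int q dvd int a - int b + m \<longleftrightarrow> (int a + m) mod int q = int b mod int q"
        by (simp add: mod_eq_dvd_iff algebra_simps)
      also have "\<dots> \<longleftrightarrow> b = b0" using that b0 by auto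
      finally show ?thesis .
    qed
    have "(\<Sum>b<q. c a * c b * (\<Sum>h\<in>balanced_residues q. turn (of_int (h * (int a - int b + m)) / real q)))
       = (\<Sum>b<q. if b = b0 then c a * c b * of_nat q else 0)"
      by (rule sum.cong[OF refl], subst sum_turn_residues[OF q], subst dvd) auto
    also have "\<dots> = c a * c b0 * of_nat q" using b0(2) by simp
    also have "c b0 = of_real (g (real a / real q + of_int m / real q))"
    proof -
      have "int a + m = int b0 + int q * ((int a + m) div int q)" unfolding b0(1) by simp
      then have "real_of_int (int a + m) = of_int (int b0 + int q * ((int a + m) div int q))" by simp
      then have "real a + of_int m = real b0 + real q * of_int ((int a + m) div int q)" by simp
      then have "real a / real q + of_int m / real q = real b0 / real q + of_int ((int a + m) div int q)"
        using q by (simp add: add_divide_distrib[symmetric] field_simps)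
      then show ?thesis by (simp only: c_def periodic_add_int[of g, OF per])
    qed
    finally show "(\<Sum>b<q. c a * c b * (\<Sum>h\<in>balanced_residues q. turn (of_int (h * (int a - int b + m)) / real q)))
       = c a * of_real (g (real a / real q + of_int m / real q)) * of_nat q" .
  qed
  also have "\<dots> / (of_nat q)\<^sup>2 = (\<Sum>a<q. c a * of_real (g (real a / real q + of_int m / real q))) / of_nat q"
    using q by (simp add: sum_distrib_right[symmetric] power2_eq_square)
  finally show ?thesis by (simp add: c_def)
qed

text \<open>
  Summation by parts: multiplying the transform by \<open>1 - w\<close>, where \<open>w\<close> is the root of unity attached to
  \<open>h\<close>, turns the values of \<open>g\<close> into their increments, whose absolute sum is at most the variation, while
  \<open>\<bar>1 - w\<bar> \<ge> \<bar>h\<bar> / q\<close> for a balanced residue.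
\<close>

lemma norm_dft_le:
  assumes per: "\<And>x. g (x + 1) = g x" and q: "1 \<le> q" and h: "h \<in> balanced_residues q" "h \<noteq> 0"
    and var: "(\<Sum>a<q. \<bar>g (real (Suc a) / real q) - g (real a / real q)\<bar>) \<le> B"
  shows "norm (dft q g h) \<le> B / of_int \<bar>h\<bar>"
proof -
  define c where "c a = complex_of_real (g (real a / real q))" for a
  define w where "w = turn (- (of_int h / real q))"
  define S where "S = (\<Sum>a<q. c a * w ^ a)"
  have "w ^ q = turn (of_int (- h))" unfolding w_def turn_power using q by simp
  then have wq: "w ^ q = 1" by (simp only: turn_eq_1_iff Ints_of_int)
  have cq: "c q = c 0" using per[of 0] q by (simp add: c_def)
  have dft: "dft q g h = S / of_nat q"
    unfolding dft_def S_def c_def w_def turn_power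
    by (intro arg_cong2[where f = "(/)"] sum.cong) (auto simp: mult_ac)
  have "(\<Sum>a<q. c (Suc a) * w ^ Suc a) = (\<Sum>a<Suc q. c a * w ^ a) - c 0"
    by (subst sum.lessThan_Suc_shift) simp
  also have "\<dots> = S" by (simp add: S_def wq cq)
  finally have shift: "(\<Sum>a<q. c (Suc a) * w ^ Suc a) = S" .
  have "(1 - w) * S = (\<Sum>a<q. c (Suc a) * w ^ Suc a) - (\<Sum>a<q. c a * w ^ Suc a)"
  proof -
    have "w * S = (\<Sum>a<q. c a * w ^ Suc a)" by (simp add: S_def sum_distrib_left mult_ac)
    then show ?thesis unfolding shift by (simp add: left_diff_distrib)
  qed
  also have "\<dots> = (\<Sum>a<q. (c (Suc a) - c a) * w ^ Suc a)"
    by (simp add: sum_subtractf left_diff_distrib)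
  finally have "norm ((1 - w) * S) \<le> (\<Sum>a<q. norm ((c (Suc a) - c a) * w ^ Suc a))"
    by (simp only: norm_sum)
  also have "\<dots> = (\<Sum>a<q. \<bar>g (real (Suc a) / real q) - g (real a / real q)\<bar>)"
    by (simp only: norm_mult norm_power w_def norm_turn c_def of_real_diff[symmetric] norm_of_real power_one mult_1_right)
  finally have up: "norm (1 - w) * norm S \<le> B" using var by (simp add: norm_mult)
  have "\<bar>- (of_int h / real q)\<bar> \<le> 1 / 2"
  proof -
    have "real_of_int (2 * \<bar>h\<bar>) \<le> of_int (int q)" using abs_le_of_residues[OF h(1)] by (simp only: of_int_le_iff)
    then show ?thesis using q by (simp add: field_simps)
  qed
  then have "of_int \<bar>h\<bar> / real q \<le> norm (1 - w)"
    using norm_turn_minus_1_ge[of "- (of_int h / real q)"] unfolding w_def by (simp add: norm_minus_commute)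
  then have "of_int \<bar>h\<bar> / real q * norm S \<le> norm (1 - w) * norm S" by (intro mult_right_mono) auto
  with up have "of_int \<bar>h\<bar> / real q * norm S \<le> B" by linarith
  then show ?thesis using h(2) q unfolding dft by (simp add: norm_divide field_simps)
qed

section \<open>Correlations along the walk\<close>

locale iid_walk = prob_space M for M :: "'w measure" +
  fixes X :: "nat \<Rightarrow> 'w \<Rightarrow> int"
  assumes indep: "indep_vars (\<lambda>_. count_space UNIV) X {1..}"
    and identically_distributed:
      "\<And>j. j \<ge> 1 \<Longrightarrow> distr M (count_space UNIV) (X j) = distr M (count_space UNIV) (X 1)"
begin

lemma measurable_step: "1 \<le> j \<Longrightarrow> X j \<in> measurable M (count_space UNIV)"
  using indep by (auto simp: indep_vars_def2)

lemma measurable_walk [measurable]: "(\<lambda>w. real_of_int (walk X k w)) \<in> borel_measurable M"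
proof -
  have "(\<lambda>w. \<Sum>j = 1..k. real_of_int (X j w)) \<in> borel_measurable M"
  proof (rule borel_measurable_sum)
    fix j assume "j \<in> {1..k}"
    then have [measurable]: "X j \<in> measurable M (count_space UNIV)" by (simp add: measurable_step)
    show "(\<lambda>w. real_of_int (X j w)) \<in> borel_measurable M" by measurable
  qed
  then show ?thesis unfolding walk_def of_int_sum .
qed

lemma corr_eq_iterated_integral:
  assumes "prob_space N" and [measurable]: "(\<lambda>u. u) \<in> measurable N borel" "g \<in> borel_measurable borel"
    and bound: "\<And>x. \<bar>g x\<bar> \<le> B"
  shows "corr N M X \<beta> g k = (\<integral>w. (\<integral>u. g u * g (u + of_int (walk X k w) * \<beta>) \<partial>N) \<partial>M)"
proof -
  interpret N: prob_space N by fact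
  interpret pair_prob_space N M ..
  have B: "0 \<le> B" using bound[of 0] by linarith
  have "integrable (N \<Otimes>\<^sub>M M) (\<lambda>(u, w). g u * g (u + of_int (walk X k w) * \<beta>))"
  proof (rule P.integrable_const_bound[where B = "B * B"])
    show "AE x in N \<Otimes>\<^sub>M M. norm (case x of (u, w) \<Rightarrow> g u * g (u + of_int (walk X k w) * \<beta>)) \<le> B * B"
      using bound B by (intro AE_I2) (auto simp: abs_mult intro!: mult_mono)
    have [measurable]: "(\<lambda>x. fst x) \<in> measurable (N \<Otimes>\<^sub>M M) borel"
      using measurable_compose[OF measurable_fst assms(2), of M] by simp
    show "(\<lambda>(u, w). g u * g (u + of_int (walk X k w) * \<beta>)) \<in> borel_measurable (N \<Otimes>\<^sub>M M)"
      unfolding split_beta by measurable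
  qed
  from integral_snd[OF this] show ?thesis by (simp add: corr_def)
qed

end

lemma prob_space_cyclic_unif: "1 \<le> q \<Longrightarrow> prob_space (cyclic_unif q)"
  unfolding cyclic_unif_def by (rule prob_space_uniform_count_measure) (auto simp: lessThan_empty_iff)

lemma integral_cyclic_unif:
  fixes g :: "real \<Rightarrow> real"
  assumes "1 \<le> q"
  shows "(\<integral>u. g u \<partial>cyclic_unif q) = (\<Sum>a<q. g (real a / real q)) / real q"
proof -
  have "inj_on (\<lambda>a. real a / real q) {..<q}" using assms by (auto simp: inj_on_def)
  then show ?thesis
    unfolding cyclic_unif_def by (simp add: integral_uniform_count_measure sum.reindex card_image)
qed

lemma measurable_cyclic_unif: "g \<in> borel_measurable (cyclic_unif q)"
  by (simp add: cyclic_unif_def uniform_count_measure_def point_measure_def)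

context iid_walk begin

text \<open>
  For a fixed value of the walk the inner average is a cyclic autocorrelation, to which Parseval applies;
  taking expectations turns each character into a power of the characteristic function.
\<close>

lemma corr_cyclic_spectral:
  assumes q: "1 \<le> q" and per: "\<And>x. g (x + 1) = g x"
    and [measurable]: "g \<in> borel_measurable borel" and bound: "\<And>x. \<bar>g x\<bar> \<le> B"
  shows "complex_of_real (corr (cyclic_unif q) M X (of_int p / real q) g k)
    = (\<Sum>h\<in>balanced_residues q. of_real ((norm (dft q g h))\<^sup>2) * chf M (X 1) (of_int h * (of_int p / real q)) ^ k)"
proof -
  have int: "integrable M (\<lambda>w. turn (t * of_int (walk X k w)))" for t
    by (rule integrable_const_bound[where B = 1]) auto
  have "corr (cyclic_unif q) M X (of_int p / real q) g k = (\<integral>w.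
     (\<Sum>a<q. g (real a / real q) * g (real a / real q + of_int (walk X k w * p) / real q)) / real q \<partial>M)"
    by (subst corr_eq_iterated_integral[OF prob_space_cyclic_unif[OF q] measurable_cyclic_unif _ bound])
      (simp_all add: integral_cyclic_unif[OF q])
  then have "complex_of_real (corr (cyclic_unif q) M X (of_int p / real q) g k) = (\<integral>w. of_real
     ((\<Sum>a<q. g (real a / real q) * g (real a / real q + of_int (walk X k w * p) / real q)) / real q) \<partial>M)"
    by (simp only: integral_complex_of_real)
  also have "\<dots> = (\<integral>w. (\<Sum>h\<in>balanced_residues q. of_real ((norm (dft q g h))\<^sup>2) *
      turn (of_int h * (of_int p / real q) * of_int (walk X k w))) \<partial>M)"
  proof -
    have "of_int h * (of_int (s * p) / real q) = of_int h * (of_int p / real q) * of_int s" for h s :: int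
      by simp
    then show ?thesis by (simp only: dft_parseval[where g = g, OF q per])
  qed
  also have "\<dots> = (\<Sum>h\<in>balanced_residues q. of_real ((norm (dft q g h))\<^sup>2) *
      (\<integral>w. turn (of_int h * (of_int p / real q) * of_int (walk X k w)) \<partial>M))"
    by (subst Bochner_Integration.integral_sum) (intro integrable_mult_right int, simp only: integral_mult_right_zero)
  finally show ?thesis
    by (simp only: integral_turn_walk[OF indep identically_distributed])
qed

end

lemma tendsto_cyclic_mean:
  assumes f: "f \<in> periodic_bv" and q: "filterlim q at_top sequentially" "\<And>n. 1 \<le> q n"
  shows "(\<lambda>n. (\<Sum>a<q n. f (real a / real (q n))) / real (q n)) \<longlonglongrightarrow> (LINT t:{0..1}|lborel. f t)"
proof -
  note [measurable] = periodic_bv_measurable[OF f]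
  obtain B where B: "\<And>x. \<bar>f x\<bar> \<le> B" using periodic_bv_bounded[OF f] by blast
  have "(\<lambda>n. (\<Sum>a<q n. f (real a / real (q n))) /\<^sub>R real (q n)) \<longlonglongrightarrow> (\<integral>u. f u \<partial>circle_unif)"
  proof (rule tendsto_grid_average[OF q])
    show "AE u in circle_unif. \<forall>v. v \<longlonglongrightarrow> u \<longrightarrow> (\<lambda>n. f (v n)) \<longlonglongrightarrow> f u"
      using AE_circle_unif_notin_countable[OF periodic_bv_countable_discontinuities[OF f]]
      by eventually_elim (auto intro: isCont_tendsto_compose)
  qed (use B in auto)
  then show ?thesis by (simp add: integral_circle_unif divide_inverse mult.commute)
qed

lemma tendsto_centered_cyclic:
  assumes f: "f \<in> periodic_bv" and q: "filterlim q at_top sequentially" "\<And>n. 1 \<le> q n"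
    and "isCont f u" "v \<longlonglongrightarrow> u"
  shows "(\<lambda>n. centered_cyclic (q n) f (v n)) \<longlonglongrightarrow> centered f u"
  unfolding centered_cyclic_def centered_def
  by (intro tendsto_diff tendsto_cyclic_mean[OF f q] isCont_tendsto_compose[OF assms(4,5)])

lemma centered_cyclic_bounded:
  assumes B: "\<And>x. \<bar>f x\<bar> \<le> B" and q: "1 \<le> q"
  shows "\<bar>centered_cyclic q f x\<bar> \<le> 2 * B"
proof -
  have "\<bar>\<Sum>a<q. f (real a / real q)\<bar> \<le> (\<Sum>a<q. \<bar>f (real a / real q)\<bar>)" by (rule sum_abs)
  also have "\<dots> \<le> real q * B" using sum_mono[of "{..<q}" "\<lambda>a. \<bar>f (real a / real q)\<bar>" "\<lambda>_. B"] B by simp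
  finally have "\<bar>(\<Sum>a<q. f (real a / real q)) / real q\<bar> \<le> B" using q by (simp add: field_simps)
  then show ?thesis using B[of x] unfolding centered_cyclic_def by linarith
qed

lemma centered_cyclic_measurable:
  "f \<in> periodic_bv \<Longrightarrow> centered_cyclic q f \<in> borel_measurable borel"
  using periodic_bv_measurable[of f] unfolding centered_cyclic_def[abs_def] by measurable

lemma centered_bounded:
  assumes f: "f \<in> periodic_bv"
  obtains B where "\<And>x. \<bar>centered f x\<bar> \<le> B"
proof -
  obtain B where B: "\<And>x. \<bar>f x\<bar> \<le> B" using periodic_bv_bounded[OF f] by blast
  show thesis
    by (rule that[of "B + \<bar>LINT t:{0..1}|lborel. f t\<bar>"])
      (use B in \<open>simp add: centered_def abs_triangle_ineq4 order_trans[OF abs_triangle_ineq4] add_mono\<close>)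
qed

definition fourier_coeff :: "(real \<Rightarrow> real) \<Rightarrow> int \<Rightarrow> complex" where
  "fourier_coeff g h = (\<integral>u. of_real (g u) * turn (- (of_int h * u)) \<partial>circle_unif)"

lemma tendsto_dft:
  assumes f: "f \<in> periodic_bv" and q: "filterlim q at_top sequentially" "\<And>n. 1 \<le> q n"
  shows "(\<lambda>n. dft (q n) (centered_cyclic (q n) f) h) \<longlonglongrightarrow> fourier_coeff (centered f) h"
proof -
  note [measurable] = periodic_bv_measurable[OF f]
  have [measurable]: "centered f \<in> borel_measurable borel" unfolding centered_def[abs_def] by measurable
  obtain B where B: "\<And>x. \<bar>f x\<bar> \<le> B" using periodic_bv_bounded[OF f] by blast
  have "(\<lambda>n. (\<Sum>a<q n. of_real (centered_cyclic (q n) f (real a / real (q n))) * turn (- (of_int h * (real a / real (q n)))))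
      /\<^sub>R real (q n)) \<longlonglongrightarrow> (\<integral>u. of_real (centered f u) * turn (- (of_int h * u)) \<partial>circle_unif)"
  proof (rule tendsto_grid_average[OF q, where B = "2 * B"])
    show "norm (of_real (centered_cyclic (q n) f x) * turn (- (of_int h * x))) \<le> 2 * B" for n x
      using centered_cyclic_bounded[OF B q(2)] by (simp add: norm_mult)
    show "AE u in circle_unif. \<forall>v. v \<longlonglongrightarrow> u \<longrightarrow>
        (\<lambda>n. of_real (centered_cyclic (q n) f (v n)) * turn (- (of_int h * v n))) \<longlonglongrightarrow>
        of_real (centered f u) * turn (- (of_int h * u))"
      using AE_circle_unif_notin_countable[OF periodic_bv_countable_discontinuities[OF f]]
      by eventually_elim (auto intro!: tendsto_intros tendsto_centered_cyclic[OF f q] isCont_tendsto_compose[OF isCont_turn])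
  qed auto
  then show ?thesis
    by (simp add: dft_def fourier_coeff_def scaleR_conv_of_real divide_inverse mult.commute)
qed

context iid_walk begin

text \<open>
  For each value \<open>s\<close> of the walk the cyclic autocorrelation is a grid average of a product of two
  translates. It converges at every \<open>u\<close> such that \<open>f\<close> is continuous at \<open>u\<close> and at \<open>u + s * \<alpha>\<close>,
  that is, outside a countable set. The bound on \<open>f\<close> then permits integrating over the walk.
\<close>

lemma tendsto_corr_cyclic:
  assumes f: "f \<in> periodic_bv" and q: "filterlim q at_top sequentially" "\<And>n. 1 \<le> q n"
    and p: "(\<lambda>n. of_int (p n) / real (q n)) \<longlonglongrightarrow> \<alpha>"
  shows "(\<lambda>n. corr (cyclic_unif (q n)) M X (of_int (p n) / real (q n)) (centered_cyclic (q n) f) k)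
     \<longlonglongrightarrow> corr circle_unif M X \<alpha> (centered f) k"
proof -
  note [measurable] = periodic_bv_measurable[OF f]
  have [measurable]: "centered f \<in> borel_measurable borel" unfolding centered_def[abs_def] by measurable
  have [measurable]: "centered_cyclic Q f \<in> borel_measurable borel" for Q
    unfolding centered_cyclic_def[abs_def] by measurable
  obtain B where B: "\<And>x. \<bar>f x\<bar> \<le> B" using periodic_bv_bounded[OF f] by blast
  have B0: "0 \<le> B" using B[of 0] by linarith
  obtain B' where B': "\<And>x. \<bar>centered f x\<bar> \<le> B'" using centered_bounded[OF f] by blast
  have id_circle: "(\<lambda>u. u) \<in> measurable circle_unif borel" by measurable
  define g where "g n = centered_cyclic (q n) f" for n
  define \<beta> where "\<beta> n = of_int (p n) / real (q n)" for n
  have gb: "\<bar>g n x\<bar> \<le> 2 * B" for n x unfolding g_def by (rule centered_cyclic_bounded[OF B q(2)])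
  have [measurable]: "g n \<in> borel_measurable borel" for n by (simp add: g_def)
  define F where "F n s = (\<Sum>a<q n. g n (real a / real (q n)) * g n (real a / real (q n) + s * \<beta> n)) / real (q n)" for n s
  define F0 where "F0 s = (\<integral>u. centered f u * centered f (u + s * \<alpha>) \<partial>circle_unif)" for s
  have corr_n: "corr (cyclic_unif (q n)) M X (\<beta> n) (g n) k = (\<integral>w. F n (of_int (walk X k w)) \<partial>M)" for n
    by (subst corr_eq_iterated_integral[OF prob_space_cyclic_unif[OF q(2)] measurable_cyclic_unif _ gb])
      (simp_all add: integral_cyclic_unif[OF q(2)] F_def)
  have corr_0: "corr circle_unif M X \<alpha> (centered f) k = (\<integral>w. F0 (of_int (walk X k w)) \<partial>M)"
    by (subst corr_eq_iterated_integral[OF prob_space_circle_unif id_circle _ B']) (simp_all add: F0_def)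
  have gg: "norm (g n x * g n y) \<le> 2 * B * (2 * B)" for n x y
    unfolding real_norm_def abs_mult using gb B0 by (intro mult_mono) auto
  have Fb: "norm (F n s) \<le> 2 * B * (2 * B)" for n s
  proof -
    have "norm (\<Sum>a<q n. g n (real a / real (q n)) * g n (real a / real (q n) + s * \<beta> n)) \<le> (\<Sum>a<q n. 2 * B * (2 * B))"
      by (intro sum_norm_le gg)
    then show ?thesis using q(2)[of n] by (simp add: F_def field_simps)
  qed
  have lim: "(\<lambda>n. F n s) \<longlonglongrightarrow> F0 s" for s
  proof -
    have "(\<lambda>n. (\<Sum>a<q n. g n (real a / real (q n)) * g n (real a / real (q n) + s * \<beta> n)) /\<^sub>R real (q n))
        \<longlonglongrightarrow> (\<integral>u. centered f u * centered f (u + s * \<alpha>) \<partial>circle_unif)"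
    proof (rule tendsto_grid_average[OF q, where B = "2 * B * (2 * B)"])
      define E where "E = {x. \<not> isCont f x}"
      have "countable (E \<union> (\<lambda>x. x - s * \<alpha>) ` E)"
        using periodic_bv_countable_discontinuities[OF f] by (simp add: E_def)
      from AE_circle_unif_notin_countable[OF this]
      show "AE u in circle_unif. \<forall>v. v \<longlonglongrightarrow> u \<longrightarrow>
        (\<lambda>n. g n (v n) * g n (v n + s * \<beta> n)) \<longlonglongrightarrow> centered f u * centered f (u + s * \<alpha>)"
      proof eventually_elim
        case (elim u)
        have "u + s * \<alpha> \<notin> E"
        proof
          assume "u + s * \<alpha> \<in> E"
          then have "(u + s * \<alpha>) - s * \<alpha> \<in> (\<lambda>x. x - s * \<alpha>) ` E" by (rule imageI)
          with elim show False by simp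
        qed
        with elim have "isCont f u" "isCont f (u + s * \<alpha>)" by (auto simp: E_def)
        then show ?case unfolding g_def \<beta>_def
          by (intro allI impI tendsto_mult tendsto_centered_cyclic[OF f q] tendsto_add tendsto_const p)
      qed
      show "norm (g n x * g n (x + s * \<beta> n)) \<le> 2 * B * (2 * B)" for n x by (rule gg)
    qed auto
    then show ?thesis by (simp add: F_def F0_def divide_inverse mult.commute)
  qed
  have [measurable]: "F n \<in> borel_measurable borel" for n unfolding F_def[abs_def] by measurable
  have [measurable]: "F0 \<in> borel_measurable borel"
    by (rule borel_measurable_LIMSEQ_real[OF lim]) auto
  have "(\<lambda>n. \<integral>w. F n (of_int (walk X k w)) \<partial>M) \<longlonglongrightarrow> (\<integral>w. F0 (of_int (walk X k w)) \<partial>M)"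
    by (rule integral_dominated_convergence[where w = "\<lambda>_. 2 * B * (2 * B)"]) (use lim Fb in auto)
  then show ?thesis by (simp add: corr_n[unfolded g_def \<beta>_def] corr_0)
qed

end

section \<open>Sums over the integers\<close>

lemma sum_residues_eq_integral:
  fixes F :: "int \<Rightarrow> 'b::{banach, second_countable_topology}"
  shows "(\<Sum>h\<in>balanced_residues q. F h) = (\<integral>h. (if h \<in> balanced_residues q then F h else 0) \<partial>count_space UNIV)"
proof -
  have fin: "finite {h \<in> UNIV. (if h \<in> balanced_residues q then F h else 0) \<noteq> 0}"
    by (rule finite_subset[OF _ finite_residues[of q]]) auto
  show ?thesis
    unfolding lebesgue_integral_count_space_finite_support[OF fin]
    by (rule sum.mono_neutral_cong_right) auto
qed

lemma integrable_count_space_finite_support: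
  fixes F :: "'a \<Rightarrow> 'b::{banach, second_countable_topology}"
  assumes "finite {x. F x \<noteq> 0}"
  shows "integrable (count_space UNIV) F"
proof -
  have "finite {x \<in> UNIV. 0 < ennreal (norm (F x))}" using assms by simp
  then show ?thesis
    by (simp add: integrable_iff_bounded nn_integral_count_space)
qed

lemma integrable_int_even:
  fixes b :: "int \<Rightarrow> real"
  assumes "summable (\<lambda>n::nat. b (int n))" "\<And>h. b (- h) = b h" "\<And>h. 0 \<le> b h"
  shows "integrable (count_space UNIV) b"
proof -
  have "Infinite_Set_Sum.abs_summable_on (\<lambda>n. b (int n)) UNIV"
    "Infinite_Set_Sum.abs_summable_on (\<lambda>n. b (- int n)) UNIV"
    using assms by (simp_all add: abs_summable_on_nat_iff')
  then have "Infinite_Set_Sum.abs_summable_on b (range int)"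
    "Infinite_Set_Sum.abs_summable_on b (range (\<lambda>n. - int n))"
    by (simp_all add: abs_summable_on_reindex_iff[symmetric] inj_on_def)
  then have "Infinite_Set_Sum.abs_summable_on b (range int \<union> range (\<lambda>n. - int n))" by (rule abs_summable_on_union)
  also have "range int \<union> range (\<lambda>n. - int n) = UNIV"
    by (auto simp: image_iff) (metis int_cases2)
  finally show ?thesis by (simp add: abs_summable_on_def)
qed

lemma integrable_inverse_square: "integrable (count_space UNIV) (\<lambda>h::int. 1 / (real_of_int h)\<^sup>2)"
  by (rule integrable_int_even) (use inverse_power_summable[of 2, where 'a = real] in \<open>simp_all add: inverse_eq_divide\<close>)

section \<open>Distances at rational points and best approximations\<close>

text \<open>
  Multiplication by \<open>m\<close> permutes the nonzero residues modulo \<open>q\<close>, and if \<open>h * m\<close> has remainder \<open>r\<close>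
  then the distance is the smaller of \<open>r / q\<close> and \<open>(q - r) / q\<close>; so the sum is at most two harmonic sums.
\<close>

lemma sum_inverse_int_dist_residues:
  assumes q: "1 \<le> q" and cop: "coprime m (int q)"
  shows "(\<Sum>h\<in>balanced_residues q - {0}. 1 / int_dist (of_int (h * m) / real q)) \<le> 2 * real q * harm q"
proof -
  define r where "r h = nat ((h * m) mod int q)" for h
  have r: "int (r h) = (h * m) mod int q" "r h < q" for h
    using q by (auto simp: r_def nat_less_iff)
  have dvd0: "int q dvd k * m \<longleftrightarrow> int q dvd k" for k
    using cop by (simp add: coprime_dvd_mult_left_iff coprime_commute)
  have rpos: "1 \<le> r h" if "h \<in> balanced_residues q - {0}" for h
  proof (rule ccontr)
    assume "\<not> 1 \<le> r h"
    then have "(h * m) mod int q = 0" using r(1)[of h] by simp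
    then have "int q dvd h" using dvd0 by (simp add: mod_eq_0_iff_dvd)
    then have "int q \<le> \<bar>h\<bar>" using that by (intro zdvd_imp_le) auto
    with abs_le_of_residues[of h q] that q show False by auto
  qed
  have inj: "inj_on r (balanced_residues q - {0})"
  proof (rule inj_onI)
    fix h h' assume hh: "h \<in> balanced_residues q - {0}" "h' \<in> balanced_residues q - {0}" "r h = r h'"
    then have "(h * m) mod int q = (h' * m) mod int q" using r(1)[of h] r(1)[of h'] by simp
    then have "int q dvd (h - h') * m" by (simp add: mod_eq_dvd_iff left_diff_distrib)
    then have d: "int q dvd h - h'" using dvd0 by simp
    show "h = h'"
    proof (rule ccontr)
      assume "h \<noteq> h'"
      then have "int q \<le> \<bar>h - h'\<bar>" using d by (intro zdvd_imp_le) auto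
      moreover have "- int q < 2 * h" "2 * h \<le> int q" "- int q < 2 * h'" "2 * h' \<le> int q"
        using hh by (auto simp: balanced_residues_def)
      ultimately show False by linarith
    qed
  qed
  have bd: "1 / int_dist (of_int (h * m) / real q) \<le> real q * (1 / real (r h) + 1 / real (q - r h))"
    if h: "h \<in> balanced_residues q - {0}" for h
  proof -
    obtain j :: int where j: "int_dist (of_int (h * m) / real q) = \<bar>of_int (h * m) / real q - of_int j\<bar>"
      by (rule int_dist_obtain)
    define d where "d = (h * m) div int q - j"
    have hm: "h * m - j * int q = int (r h) + int q * d"
      unfolding d_def r(1) by (simp add: right_diff_distrib)
    have "of_int (h * m) / real q - of_int j = of_int (h * m - j * int q) / real q"
      using q by (simp add: field_simps)
    then have dist: "int_dist (of_int (h * m) / real q) = real_of_int \<bar>int (r h) + int q * d\<bar> / real q"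
      unfolding j hm by simp
    show ?thesis
    proof (cases "0 \<le> d")
      case True
      then have "int (r h) \<le> \<bar>int (r h) + int q * d\<bar>" by simp
      then have "real (r h) \<le> real_of_int \<bar>int (r h) + int q * d\<bar>" by linarith
      then have "real (r h) / real q \<le> int_dist (of_int (h * m) / real q)"
        unfolding dist by (intro divide_right_mono) auto
      then have "1 / int_dist (of_int (h * m) / real q) \<le> 1 / (real (r h) / real q)"
        by (rule frac_le[rotated 3]) (use rpos[OF h] q in auto)
      also have "\<dots> = real q * (1 / real (r h))" by simp
      also have "\<dots> \<le> real q * (1 / real (r h) + 1 / real (q - r h))"
        by (intro mult_left_mono) auto
      finally show ?thesis .
    next
      case False
      then have "int q * d \<le> int q * (- 1)" by (intro mult_left_mono) auto
      then have "int (q - r h) \<le> \<bar>int (r h) + int q * d\<bar>" using r(2)[of h] by (simp add: of_nat_diff)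
      then have "real (q - r h) \<le> real_of_int \<bar>int (r h) + int q * d\<bar>" by linarith
      then have "real (q - r h) / real q \<le> int_dist (of_int (h * m) / real q)"
        unfolding dist by (intro divide_right_mono) auto
      then have "1 / int_dist (of_int (h * m) / real q) \<le> 1 / (real (q - r h) / real q)"
        by (rule frac_le[rotated 3]) (use r(2)[of h] q in auto)
      also have "\<dots> = real q * (1 / real (q - r h))" by simp
      also have "\<dots> \<le> real q * (1 / real (r h) + 1 / real (q - r h))"
        by (intro mult_left_mono) auto
      finally show ?thesis .
    qed
  qed
  have "(\<Sum>h\<in>balanced_residues q - {0}. 1 / int_dist (of_int (h * m) / real q))
      \<le> (\<Sum>h\<in>balanced_residues q - {0}. real q * (1 / real (r h) + 1 / real (q - r h)))"
    by (rule sum_mono) (rule bd)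
  also have "\<dots> = (\<Sum>s\<in>r ` (balanced_residues q - {0}). real q * (1 / real s + 1 / real (q - s)))"
    using inj by (simp add: sum.reindex)
  also have "\<dots> \<le> (\<Sum>s\<in>{1..<q}. real q * (1 / real s + 1 / real (q - s)))"
  proof (rule sum_mono2)
    show "r ` (balanced_residues q - {0}) \<subseteq> {1..<q}"
    proof (rule image_subsetI)
      fix h assume "h \<in> balanced_residues q - {0}"
      from rpos[OF this] r(2)[of h] show "r h \<in> {1..<q}" by simp
    qed
  qed auto
  also have "\<dots> = real q * ((\<Sum>s\<in>{1..<q}. 1 / real s) + (\<Sum>s\<in>{1..<q}. 1 / real (q - s)))"
    by (simp only: sum_distrib_left[symmetric] sum.distrib)
  also have "(\<Sum>s\<in>{1..<q}. 1 / real (q - s)) = (\<Sum>s\<in>{1..<q}. 1 / real s)"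
    by (rule sum.reindex_bij_witness[of _ "\<lambda>s. q - s" "\<lambda>s. q - s"]) auto
  also have "real q * ((\<Sum>s\<in>{1..<q}. 1 / real s) + (\<Sum>s\<in>{1..<q}. 1 / real s)) \<le> real q * (harm q + harm q)"
  proof -
    have "(\<Sum>s\<in>{1..<q}. 1 / real s) \<le> harm q"
      unfolding harm_def inverse_eq_divide by (intro sum_mono2) auto
    then show ?thesis by (intro mult_left_mono add_mono) auto
  qed
  finally show ?thesis by simp
qed

lemma harm_over_n: "(\<lambda>n. harm n / real n) \<longlonglongrightarrow> 0"
proof -
  have "(\<lambda>n. (harm n - ln (real n)) * (1 / real n) + ln (real n) / real n) \<longlonglongrightarrow> euler_mascheroni * 0 + 0"
    by (intro tendsto_intros euler_mascheroni_LIMSEQ lim_1_over_n lim_ln_over_n)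
  then show ?thesis by (simp add: diff_divide_distrib)
qed

text \<open>
  Since \<open>n < q\<close>, minimality bounds \<open>\<parallel>q \<alpha>\<parallel>\<close> by \<open>\<parallel>n \<alpha>\<parallel>\<close>. Replacing \<open>\<alpha>\<close> by \<open>p / q\<close> moves \<open>n * \<alpha>\<close>
  by \<open>n / q\<close> times \<open>\<parallel>q \<alpha>\<parallel>\<close>, which is at most half of \<open>\<parallel>n \<alpha>\<parallel>\<close> because \<open>2 * n \<le> q\<close>.
\<close>

lemma best_approx_int_dist:
  assumes best: "(p, q) \<in> best_approx \<alpha>" and n: "0 < n" "2 * n \<le> q"
  shows "int_dist (real n * \<alpha>) \<le> 2 * int_dist (real n * (of_int p / real q))"
proof -
  have q: "1 \<le> q" "\<bar>real q * \<alpha> - of_int p\<bar> = int_dist (real q * \<alpha>)"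
    and low: "int_dist (real q * \<alpha>) \<le> int_dist (real n * \<alpha>)"
    using best n by (auto simp: best_approx_def)
  have "real n * \<alpha> - real n * (of_int p / real q) = real n / real q * (real q * \<alpha> - of_int p)"
    using q by (simp add: field_simps)
  then have "\<bar>real n * \<alpha> - real n * (of_int p / real q)\<bar> = real n / real q * int_dist (real q * \<alpha>)"
    by (simp add: abs_mult q(2))
  also have "\<dots> \<le> 1 / 2 * int_dist (real n * \<alpha>)"
    using n q low by (intro mult_mono int_dist_nonneg) (auto simp: field_simps)
  finally show ?thesis
    using int_dist_diff_le[of "real n * \<alpha>" "real n * (of_int p / real q)"] by linarith
qed

lemma best_approx_error:
  assumes "(p, q) \<in> best_approx \<alpha>"
  shows "\<bar>of_int p / real q - \<alpha>\<bar> \<le> 1 / real q"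
proof -
  have q: "1 \<le> q" "\<bar>real q * \<alpha> - of_int p\<bar> = int_dist (real q * \<alpha>)"
    using assms by (auto simp: best_approx_def)
  have "of_int p / real q - \<alpha> = (of_int p - real q * \<alpha>) / real q" using q by (simp add: field_simps)
  then have "\<bar>of_int p / real q - \<alpha>\<bar> = int_dist (real q * \<alpha>) / real q"
    using q(2) by (simp add: abs_minus_commute)
  also have "\<dots> \<le> 1 / real q"
    using int_dist_le_half[of "real q * \<alpha>"] by (intro divide_right_mono) auto
  finally show ?thesis .
qed

section \<open>Summation over time\<close>

lemma norm_cayley_le:
  fixes z :: complex
  assumes "norm z \<le> 1" "z \<noteq> 1"
  shows "norm (1 + 2 * (z / (1 - z))) \<le> 2 / norm (1 - z)"
proof -
  have "1 + 2 * (z / (1 - z)) = (1 + z) / (1 - z)" using assms(2) by (simp add: field_simps)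
  moreover have "norm (1 + z) \<le> 2" using norm_triangle_ineq[of 1 z] assms(1) by simp
  ultimately show ?thesis by (simp add: norm_divide divide_right_mono)
qed

text \<open>
  Summing the geometric series frequency by frequency. The partial sums have the factor
  \<open>1 - z h ^ K\<close>, of modulus at most \<open>2\<close>, so \<open>a h / \<bar>1 - z h\<bar>\<close> dominates them up to a constant.
  Where \<open>\<bar>z h\<bar> = 1\<close> the geometric series diverges, so such a frequency must carry no weight.
\<close>

lemma spectral_series:
  fixes a :: "int \<Rightarrow> real" and z :: "int \<Rightarrow> complex" and c :: "nat \<Rightarrow> real"
  assumes c: "\<And>k. complex_of_real (c k) = (\<integral>h. of_real (a h) * z h ^ k \<partial>count_space UNIV)"
    and a: "integrable (count_space UNIV) a" "\<And>h. 0 \<le> a h"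
    and z: "\<And>h. norm (z h) \<le> 1" "\<And>h. a h \<noteq> 0 \<Longrightarrow> norm (z h) < 1"
    and int: "integrable (count_space UNIV) (\<lambda>h. a h / norm (1 - z h))"
  shows "summable (\<lambda>k. c (Suc k))"
    and "complex_of_real (c 0 + 2 * (\<Sum>k. c (Suc k)))
      = (\<integral>h. of_real (a h) * (1 + 2 * (z h / (1 - z h))) \<partial>count_space UNIV)"
proof -
  let ?N = "count_space (UNIV :: int set)"
  have ia: "integrable ?N (\<lambda>h. complex_of_real (a h))" using a(1) by simp
  have ik: "integrable ?N (\<lambda>h. of_real (a h) * z h ^ k)" for k
    by (rule Bochner_Integration.integrable_bound[OF a(1)])
      (use a(2) z(1) in \<open>auto simp: norm_mult norm_power intro!: mult_left_le power_le_one\<close>)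
  have ilim: "integrable ?N (\<lambda>h. of_real (a h) * (z h / (1 - z h)))"
    by (rule Bochner_Integration.integrable_bound[OF int])
      (use a(2) z(1) in \<open>auto simp: norm_mult norm_divide intro!: divide_right_mono mult_left_le\<close>)
  have geo: "(\<Sum>k<K. of_real (a h) * z h ^ Suc k) = of_real (a h) * (z h * (1 - z h ^ K) / (1 - z h))" for h K
  proof (cases "a h = 0")
    case False
    then have "z h \<noteq> 1" using z(2)[of h] by auto
    then have "(\<Sum>k<K. z h ^ k) = (1 - z h ^ K) / (1 - z h)" by (simp add: sum_gp_strict)
    moreover have "(\<Sum>k<K. of_real (a h) * z h ^ Suc k) = of_real (a h) * (z h * (\<Sum>k<K. z h ^ k))"
      by (simp add: sum_distrib_left mult_ac)
    ultimately show ?thesis by simp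
  qed simp
  have partial: "(\<Sum>k<K. complex_of_real (c (Suc k))) = (\<integral>h. of_real (a h) * (z h * (1 - z h ^ K) / (1 - z h)) \<partial>?N)" for K
    unfolding c geo[symmetric] by (rule Bochner_Integration.integral_sum[symmetric]) (rule ik)
  have "(\<lambda>K. \<integral>h. of_real (a h) * (z h * (1 - z h ^ K) / (1 - z h)) \<partial>?N) \<longlonglongrightarrow> (\<integral>h. of_real (a h) * (z h / (1 - z h)) \<partial>?N)"
  proof (rule integral_dominated_convergence[where w = "\<lambda>h. 2 * (a h / norm (1 - z h))"])
    show "integrable ?N (\<lambda>h. 2 * (a h / norm (1 - z h)))" by (intro integrable_mult_right int)
    show "AE h in ?N. (\<lambda>K. of_real (a h) * (z h * (1 - z h ^ K) / (1 - z h))) \<longlonglongrightarrow> of_real (a h) * (z h / (1 - z h))"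
    proof (rule AE_I2)
      fix h
      show "(\<lambda>K. of_real (a h) * (z h * (1 - z h ^ K) / (1 - z h))) \<longlonglongrightarrow> of_real (a h) * (z h / (1 - z h))"
      proof (cases "a h = 0")
        case False
        then have lt: "norm (z h) < 1" by (rule z(2))
        then have "1 - z h \<noteq> 0" by auto
        then have "(\<lambda>K. of_real (a h) * (z h * (1 - z h ^ K) / (1 - z h))) \<longlonglongrightarrow> of_real (a h) * (z h * (1 - 0) / (1 - z h))"
          by (intro tendsto_intros LIMSEQ_power_zero lt) auto
        then show ?thesis by simp
      qed simp
    qed
    show "AE h in ?N. norm (of_real (a h) * (z h * (1 - z h ^ K) / (1 - z h))) \<le> 2 * (a h / norm (1 - z h))" for K
    proof (rule AE_I2)
      fix h
      have "norm (1 - z h ^ K) \<le> 2"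
        using norm_triangle_ineq4[of 1 "z h ^ K"] power_le_one[of "norm (z h)" K] z(1)[of h] by (simp add: norm_power)
      then have "norm (z h) * norm (1 - z h ^ K) \<le> 1 * 2" using z(1) by (intro mult_mono) auto
      then have "a h * (norm (z h) * norm (1 - z h ^ K)) / norm (1 - z h) \<le> a h * 2 / norm (1 - z h)"
        using a(2) by (intro divide_right_mono mult_left_mono) auto
      then show "norm (of_real (a h) * (z h * (1 - z h ^ K) / (1 - z h))) \<le> 2 * (a h / norm (1 - z h))"
        using a(2)[of h] by (simp add: norm_mult norm_divide mult.commute)
    qed
  qed auto
  then have sums: "(\<lambda>k. complex_of_real (c (Suc k))) sums (\<integral>h. of_real (a h) * (z h / (1 - z h)) \<partial>?N)"
    unfolding sums_def partial .
  then have "summable (\<lambda>k. complex_of_real (c (Suc k)))" by (rule sums_summable)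
  then show s: "summable (\<lambda>k. c (Suc k))" by (simp add: summable_complex_iff)
  have "complex_of_real (\<Sum>k. c (Suc k)) = (\<integral>h. of_real (a h) * (z h / (1 - z h)) \<partial>?N)"
    using sums suminf_of_real[OF s, where 'a = complex] by (simp add: sums_iff)
  then have "complex_of_real (c 0 + 2 * (\<Sum>k. c (Suc k))) =
      (\<integral>h. of_real (a h) \<partial>?N) + 2 * (\<integral>h. of_real (a h) * (z h / (1 - z h)) \<partial>?N)"
    using c[of 0] by simp
  also have "\<dots> = (\<integral>h. of_real (a h) + 2 * (of_real (a h) * (z h / (1 - z h))) \<partial>?N)"
    by (subst Bochner_Integration.integral_add[OF ia]) (intro integrable_mult_right ilim, simp only: integral_mult_right_zero)
  finally show "complex_of_real (c 0 + 2 * (\<Sum>k. c (Suc k)))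
      = (\<integral>h. of_real (a h) * (1 + 2 * (z h / (1 - z h))) \<partial>?N)"
    by (simp add: algebra_simps)
qed

section \<open>Fourier weights\<close>

lemma dft_centered_cyclic_0: "dft q (centered_cyclic q f) 0 = 0"
proof (cases "q = 0")
  case False
  then have "(\<Sum>a<q. centered_cyclic q f (real a / real q)) = 0"
    by (simp add: centered_cyclic_def sum_subtractf)
  then have "(\<Sum>a<q. complex_of_real (centered_cyclic q f (real a / real q))) = 0"
    by (simp only: of_real_sum[symmetric] of_real_0)
  then show ?thesis by (simp add: dft_def)
qed (simp add: dft_def)

text \<open>
  The squared transform extended by \<open>0\<close> to all integers, so that the sums for all \<open>q\<close> run over the same
  index set.
\<close>

definition weight :: "nat \<Rightarrow> (real \<Rightarrow> real) \<Rightarrow> int \<Rightarrow> real" where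
  "weight q f h = (if h \<in> balanced_residues q then (norm (dft q (centered_cyclic q f) h))\<^sup>2 else 0)"

lemma weight_nonneg: "0 \<le> weight q f h"
  by (simp add: weight_def)

lemma weight_0: "weight q f 0 = 0"
  by (simp add: weight_def dft_centered_cyclic_0)

lemma weight_finite_support: "finite {h. weight q f h \<noteq> 0}"
  by (rule finite_subset[OF _ finite_residues[of q]]) (auto simp: weight_def)

text \<open>
  The right side is \<open>0\<close> at \<open>h = 0\<close> because division by zero gives zero; this agrees with the vanishing of
  the zeroth coefficient of a centred function.
\<close>

lemma weight_bound:
  assumes f: "f \<in> periodic_bv"
  obtains K where "0 \<le> K" "\<And>q h. 1 \<le> q \<Longrightarrow> weight q f h \<le> K / (of_int h)\<^sup>2"
proof -
  obtain B where B: "0 \<le> B"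
    "\<And>q. 1 \<le> q \<Longrightarrow> (\<Sum>a<q. \<bar>f (real (Suc a) / real q) - f (real a / real q)\<bar>) \<le> B"
    using periodic_bv_cyclic_variation[OF f] by blast
  have "weight q f h \<le> B\<^sup>2 / (of_int h)\<^sup>2" if q: "1 \<le> q" for q h
  proof (cases "h \<in> balanced_residues q \<and> h \<noteq> 0")
    case True
    have "norm (dft q (centered_cyclic q f) h) \<le> B / of_int \<bar>h\<bar>"
    proof (rule norm_dft_le[OF _ q])
      show "centered_cyclic q f (x + 1) = centered_cyclic q f x" for x
        using f by (simp add: centered_cyclic_def periodic_bv_def)
      show "(\<Sum>a<q. \<bar>centered_cyclic q f (real (Suc a) / real q) - centered_cyclic q f (real a / real q)\<bar>) \<le> B"
        using B(2)[OF q] by (simp add: centered_cyclic_def)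
    qed (use True in auto)
    then have "(norm (dft q (centered_cyclic q f) h))\<^sup>2 \<le> (B / of_int \<bar>h\<bar>)\<^sup>2" by (rule power_mono) simp
    then show ?thesis using True by (simp add: weight_def power_divide)
  next
    case False
    then show ?thesis by (auto simp: weight_def dft_centered_cyclic_0)
  qed
  then show thesis using that[of "B\<^sup>2"] by simp
qed

lemma tendsto_weight:
  assumes f: "f \<in> periodic_bv" and q: "filterlim q at_top sequentially" "\<And>n. 1 \<le> q n"
  shows "(\<lambda>n. weight (q n) f h) \<longlonglongrightarrow> (norm (fourier_coeff (centered f) h))\<^sup>2"
proof -
  have "eventually (\<lambda>n. nat (2 * \<bar>h\<bar> + 1) \<le> q n) sequentially"
    using q(1) by (simp add: filterlim_at_top)
  then have "eventually (\<lambda>n. (norm (dft (q n) (centered_cyclic (q n) f) h))\<^sup>2 = weight (q n) f h) sequentially"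
    by eventually_elim (auto simp: weight_def balanced_residues_def)
  moreover have "(\<lambda>n. (norm (dft (q n) (centered_cyclic (q n) f) h))\<^sup>2) \<longlonglongrightarrow> (norm (fourier_coeff (centered f) h))\<^sup>2"
    by (intro tendsto_intros tendsto_dft[OF f q])
  ultimately show ?thesis by (simp add: tendsto_cong)
qed

context iid_walk begin

lemma corr_series_eq:
  assumes N: "prob_space N" and id: "(\<lambda>u. u) \<in> measurable N borel" and g: "g \<in> borel_measurable borel"
    and bound: "\<And>x. \<bar>g x\<bar> \<le> B"
  shows "corr_series N M X \<beta> g = corr N M X \<beta> g 0 + 2 * (\<Sum>k. corr N M X \<beta> g (Suc k))"
proof -
  have "corr N M X \<beta> g 0 = (\<integral>w. (\<integral>u. (g u)\<^sup>2 \<partial>N) \<partial>M)"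
    unfolding corr_eq_iterated_integral[OF N id g bound] by (simp add: walk_def power2_eq_square)
  then show ?thesis by (simp add: corr_series_def prob_space)
qed

lemma corr_cyclic_eq_integral:
  assumes f: "f \<in> periodic_bv" and q: "1 \<le> q"
  shows "complex_of_real (corr (cyclic_unif q) M X (of_int p / real q) (centered_cyclic q f) k)
    = (\<integral>h. of_real (weight q f h) * chf M (X 1) (of_int h * (of_int p / real q)) ^ k \<partial>count_space UNIV)"
proof -
  obtain B where B: "\<And>x. \<bar>f x\<bar> \<le> B" using periodic_bv_bounded[OF f] by blast
  have "complex_of_real (corr (cyclic_unif q) M X (of_int p / real q) (centered_cyclic q f) k)
    = (\<Sum>h\<in>balanced_residues q. of_real ((norm (dft q (centered_cyclic q f) h))\<^sup>2) *
        chf M (X 1) (of_int h * (of_int p / real q)) ^ k)"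
  proof (rule corr_cyclic_spectral[OF q])
    show "centered_cyclic q f (x + 1) = centered_cyclic q f x" for x
      using f by (simp add: centered_cyclic_def periodic_bv_def)
    show "\<bar>centered_cyclic q f x\<bar> \<le> 2 * B" for x by (rule centered_cyclic_bounded[OF B q])
  qed (rule centered_cyclic_measurable[OF f])
  then show ?thesis
    unfolding sum_residues_eq_integral
    by (simp add: weight_def if_distrib[of "\<lambda>x. x * _"] if_distrib[of complex_of_real] cong: if_cong)
qed

text \<open>
  The limit of the finite formula along \<open>q n\<close>: the left side converges by \<open>tendsto_corr_cyclic\<close>, the
  right side termwise with the dominating sequence \<open>K / h\<^sup>2\<close>.
\<close>

lemma corr_circle_eq_integral:
  assumes f: "f \<in> periodic_bv" and q: "filterlim q at_top sequentially" "\<And>n. 1 \<le> q n"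
    and p: "(\<lambda>n. of_int (p n) / real (q n)) \<longlonglongrightarrow> \<alpha>"
  shows "complex_of_real (corr circle_unif M X \<alpha> (centered f) k)
    = (\<integral>h. of_real ((norm (fourier_coeff (centered f) h))\<^sup>2) * chf M (X 1) (of_int h * \<alpha>) ^ k \<partial>count_space UNIV)"
proof -
  have X1 [measurable]: "X 1 \<in> measurable M (count_space UNIV)" by (rule measurable_step) simp
  obtain K where K: "0 \<le> K" "\<And>q h. 1 \<le> q \<Longrightarrow> weight q f h \<le> K / (of_int h)\<^sup>2"
    using weight_bound[OF f] by blast
  have "(\<lambda>n. \<integral>h. of_real (weight (q n) f h) * chf M (X 1) (of_int h * (of_int (p n) / real (q n))) ^ k \<partial>count_space UNIV)
    \<longlonglongrightarrow> (\<integral>h. of_real ((norm (fourier_coeff (centered f) h))\<^sup>2) * chf M (X 1) (of_int h * \<alpha>) ^ k \<partial>count_space UNIV)"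
  proof (rule integral_dominated_convergence[where w = "\<lambda>h. K * (1 / (of_int h)\<^sup>2)"])
    show "integrable (count_space UNIV) (\<lambda>h::int. K * (1 / (real_of_int h)\<^sup>2))"
      by (intro integrable_mult_right integrable_inverse_square)
    show "AE h in count_space UNIV.
        (\<lambda>n. of_real (weight (q n) f h) * chf M (X 1) (of_int h * (of_int (p n) / real (q n))) ^ k) \<longlonglongrightarrow>
        of_real ((norm (fourier_coeff (centered f) h))\<^sup>2) * chf M (X 1) (of_int h * \<alpha>) ^ k"
      by (intro AE_I2 tendsto_mult tendsto_of_real tendsto_weight[OF f q] tendsto_power tendsto_chf[OF X1] tendsto_const p)
    show "AE h in count_space UNIV. norm (of_real (weight (q n) f h) * chf M (X 1) (of_int h * (of_int (p n) / real (q n))) ^ k)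
        \<le> K * (1 / (of_int h)\<^sup>2)" for n
    proof (rule AE_I2)
      fix h
      have "weight (q n) f h * norm (chf M (X 1) (of_int h * (of_int (p n) / real (q n)))) ^ k \<le> weight (q n) f h * 1"
        by (intro mult_left_mono power_le_one norm_chf_le_1[OF X1] weight_nonneg norm_ge_zero)
      with K(2)[OF q(2), of n h]
      show "norm (of_real (weight (q n) f h) * chf M (X 1) (of_int h * (of_int (p n) / real (q n))) ^ k)
        \<le> K * (1 / (of_int h)\<^sup>2)"
        using weight_nonneg[of "q n" f h] by (simp add: norm_mult norm_power)
    qed
  qed auto
  then have "(\<lambda>n. complex_of_real (corr (cyclic_unif (q n)) M X (of_int (p n) / real (q n)) (centered_cyclic (q n) f) k))
    \<longlonglongrightarrow> (\<integral>h. of_real ((norm (fourier_coeff (centered f) h))\<^sup>2) * chf M (X 1) (of_int h * \<alpha>) ^ k \<partial>count_space UNIV)"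
    unfolding corr_cyclic_eq_integral[OF f q(2)] .
  moreover have "(\<lambda>n. complex_of_real (corr (cyclic_unif (q n)) M X (of_int (p n) / real (q n)) (centered_cyclic (q n) f) k))
    \<longlonglongrightarrow> complex_of_real (corr circle_unif M X \<alpha> (centered f) k)"
    by (intro tendsto_of_real tendsto_corr_cyclic[OF f q p])
  ultimately show ?thesis using LIMSEQ_unique by blast
qed

text \<open>
  The product being an integer would make \<open>q\<close> divide \<open>D * p * h\<close> and hence \<open>h\<close>, but a nonzero balanced
  residue is smaller than \<open>q\<close> in absolute value.
\<close>

lemma gcd_times_frequency_notin_Ints:
  assumes "coprime D (int q)" "coprime p (int q)" "1 \<le> q" "h \<in> balanced_residues q" "h \<noteq> 0"
  shows "real_of_int D * (of_int h * (of_int p / real q)) \<notin> \<int>"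
proof
  assume "real_of_int D * (of_int h * (of_int p / real q)) \<in> \<int>"
  then obtain j :: int where "real_of_int D * (of_int h * (of_int p / real q)) = of_int j"
    by (elim Ints_cases)
  then have "real_of_int (D * p * h) = of_int (j * int q)" using assms(3) by (simp add: field_simps)
  then have "D * p * h = j * int q" by (simp only: of_int_eq_iff)
  then have "int q dvd D * p * h" by simp
  moreover have "coprime (int q) (D * p)" using assms(1,2) by (simp add: coprime_commute)
  ultimately have "int q dvd h" by (simp add: coprime_dvd_mult_right_iff)
  then have "int q \<le> \<bar>h\<bar>" using assms(5) by (intro zdvd_imp_le) auto
  with abs_le_of_residues[OF assms(4)] assms(3) show False by linarith
qed

lemma cyclic_series:
  assumes f: "f \<in> periodic_bv" and q: "1 \<le> q" and p: "coprime p (int q)"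
    and nd: "\<not> (\<exists>c. AE w in M. X 1 w = c)" and D: "coprime (gcd_diff_supp M (X 1)) (int q)"
  shows "summable (\<lambda>k. corr (cyclic_unif q) M X (of_int p / real q) (centered_cyclic q f) (Suc k))"
    and "complex_of_real (C_rat M X p q f) = (\<integral>h. of_real (weight q f h) *
      (1 + 2 * (chf M (X 1) (of_int h * (of_int p / real q)) / (1 - chf M (X 1) (of_int h * (of_int p / real q)))))
      \<partial>count_space UNIV)"
proof -
  have X1 [measurable]: "X 1 \<in> measurable M (count_space UNIV)" by (rule measurable_step) simp
  obtain B where B: "\<And>x. \<bar>f x\<bar> \<le> B" using periodic_bv_bounded[OF f] by blast
  let ?z = "\<lambda>h. chf M (X 1) (of_int h * (of_int p / real q))"
  have lt: "norm (?z h) < 1" if "weight q f h \<noteq> 0" for h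
  proof -
    have "h \<in> balanced_residues q" "h \<noteq> 0" using that by (auto simp: weight_def dft_centered_cyclic_0 split: if_splits)
    then have "norm (?z h) \<noteq> 1"
      using gcd_times_frequency_notin_Ints[OF D p q] chf_unimodular_imp_Ints[OF X1 nd] by blast
    then show ?thesis using norm_chf_le_1[OF X1, of "of_int h * (of_int p / real q)"] by linarith
  qed
  have i1: "integrable (count_space UNIV) (weight q f)"
    by (rule integrable_count_space_finite_support[OF weight_finite_support])
  have i2: "integrable (count_space UNIV) (\<lambda>h. weight q f h / norm (1 - ?z h))"
    by (rule integrable_count_space_finite_support, rule finite_subset[OF _ weight_finite_support[of q f]]) auto
  note series = spectral_series[OF corr_cyclic_eq_integral[OF f q] i1 weight_nonneg norm_chf_le_1[OF X1] lt i2]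
  from series(1) show "summable (\<lambda>k. corr (cyclic_unif q) M X (of_int p / real q) (centered_cyclic q f) (Suc k))" .
  show "complex_of_real (C_rat M X p q f) = (\<integral>h. of_real (weight q f h) * (1 + 2 * (?z h / (1 - ?z h))) \<partial>count_space UNIV)"
    unfolding C_rat_def corr_series_eq[OF prob_space_cyclic_unif[OF q] measurable_cyclic_unif
          centered_cyclic_measurable[OF f] centered_cyclic_bounded[OF B q]]
    by (rule series(2))
qed

end

section \<open>Convergence along the best approximations\<close>

lemma int_dist_irrational_multiple_pos:
  assumes "\<alpha> \<notin> \<rat>" "D \<noteq> 0" "h \<noteq> 0"
  shows "0 < int_dist (of_int D * (of_int h * \<alpha>))"
proof -
  have "of_int D * (of_int h * \<alpha>) \<notin> \<int>"
  proof
    assume "of_int D * (of_int h * \<alpha>) \<in> \<int>"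
    then obtain j :: int where "of_int D * (of_int h * \<alpha>) = of_int j" by (elim Ints_cases)
    then have "\<alpha> = of_int j / of_int (D * h)" using assms(2,3) by (simp add: field_simps)
    then have "\<alpha> \<in> \<rat>" by simp
    with assms(1) show False ..
  qed
  then show ?thesis
    using int_dist_eq_0_iff[of "of_int D * (of_int h * \<alpha>)"] int_dist_nonneg[of "of_int D * (of_int h * \<alpha>)"]
    by linarith
qed

text \<open>
  Passing from \<open>\<alpha>\<close> to \<open>D * \<alpha>\<close> only changes the constant in the Diophantine condition.
\<close>

lemma integrable_inverse_square_int_dist:
  fixes \<alpha> \<gamma> c :: real and D :: int
  assumes c: "0 < c" and \<gamma>: "0 < \<gamma>" "\<gamma> < 2" and D: "0 < D"
    and low: "\<And>h::int. h \<noteq> 0 \<Longrightarrow> c \<le> \<bar>of_int h\<bar> powr \<gamma> * int_dist (of_int h * \<alpha>)"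
  shows "integrable (count_space UNIV) (\<lambda>h::int. 1 / ((of_int h)\<^sup>2 * int_dist (of_int D * (of_int h * \<alpha>))))"
proof (rule integrable_int_even)
  have D0: "0 < real_of_int D" using D by simp
  have "summable (\<lambda>n::nat. 1 / ((real n)\<^sup>2 * int_dist (real n * (of_int D * \<alpha>))))"
  proof (rule summable_inverse_square_int_dist)
    show "0 < c * of_int D powr (- \<gamma>)" using c D0 by simp
    fix n :: nat assume n: "1 \<le> n"
    have "c \<le> \<bar>of_int (int n * D)\<bar> powr \<gamma> * int_dist (of_int (int n * D) * \<alpha>)"
      using n D by (intro low) auto
    also have "\<bar>real_of_int (int n * D)\<bar> = real n * of_int D" using D0 by simp
    also have "real_of_int (int n * D) * \<alpha> = real n * (of_int D * \<alpha>)" by simp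
    finally have *: "c \<le> (real n * of_int D) powr \<gamma> * int_dist (real n * (of_int D * \<alpha>))" .
    have pos: "0 < (real n * of_int D) powr \<gamma>" using n D0 by simp
    have "c * of_int D powr (- \<gamma>) * real n powr (- \<gamma>) = c / (real n * of_int D) powr \<gamma>"
      using n D0 by (simp add: powr_mult powr_minus_divide)
    also have "\<dots> \<le> int_dist (real n * (of_int D * \<alpha>))"
      using * pos by (simp add: pos_divide_le_eq mult.commute)
    finally show "c * of_int D powr (- \<gamma>) * real n powr (- \<gamma>) \<le> int_dist (real n * (of_int D * \<alpha>))" .
  qed (use \<gamma> in auto)
  then show "summable (\<lambda>n. 1 / ((real_of_int (int n))\<^sup>2 * int_dist (real_of_int D * (real_of_int (int n) * \<alpha>))))"
    by (simp add: mult.left_commute)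
  show "1 / ((real_of_int (- h))\<^sup>2 * int_dist (real_of_int D * (real_of_int (- h) * \<alpha>)))
      = 1 / ((real_of_int h)\<^sup>2 * int_dist (real_of_int D * (real_of_int h * \<alpha>)))" for h
    using int_dist_minus[of "real_of_int D * (real_of_int h * \<alpha>)"] by simp
  show "0 \<le> 1 / ((real_of_int h)\<^sup>2 * int_dist (real_of_int D * (real_of_int h * \<alpha>)))" for h
    by (simp add: int_dist_nonneg)
qed

context iid_walk begin

text \<open>
  For irrational \<open>\<alpha>\<close> no nonzero frequency \<open>h * \<alpha>\<close> is a unimodular point of the characteristic function,
  and the linear lower bound for \<open>\<bar>1 - chf\<bar>\<close> turns the summability of the inverse distances into the
  domination required by \<open>spectral_series\<close>.
\<close>

lemma circle_series:
  fixes \<alpha> :: real and c :: real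
  assumes f: "f \<in> periodic_bv" and q: "filterlim q at_top sequentially" "\<And>n. 1 \<le> q n"
    and p: "(\<lambda>n. of_int (p n) / real (q n)) \<longlonglongrightarrow> \<alpha>"
    and nd: "\<not> (\<exists>c. AE w in M. X 1 w = c)" and \<alpha>: "\<alpha> \<notin> \<rat>"
    and c: "0 < c" "\<And>t. c * int_dist (of_int (gcd_diff_supp M (X 1)) * t) \<le> norm (1 - chf M (X 1) t)"
    and dom: "integrable (count_space UNIV)
      (\<lambda>h::int. 1 / ((of_int h)\<^sup>2 * int_dist (of_int (gcd_diff_supp M (X 1)) * (of_int h * \<alpha>))))"
  shows "summable (\<lambda>k. corr circle_unif M X \<alpha> (centered f) (Suc k))"
    and "complex_of_real (C_irr M X \<alpha> f) = (\<integral>h. of_real ((norm (fourier_coeff (centered f) h))\<^sup>2) *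
      (1 + 2 * (chf M (X 1) (of_int h * \<alpha>) / (1 - chf M (X 1) (of_int h * \<alpha>)))) \<partial>count_space UNIV)"
proof -
  have X1 [measurable]: "X 1 \<in> measurable M (count_space UNIV)" by (rule measurable_step) simp
  obtain K where K: "0 \<le> K" "\<And>q h. 1 \<le> q \<Longrightarrow> weight q f h \<le> K / (of_int h)\<^sup>2"
    using weight_bound[OF f] by blast
  obtain B where B: "\<And>x. \<bar>centered f x\<bar> \<le> B" using centered_bounded[OF f] by blast
  define D where "D = gcd_diff_supp M (X 1)"
  have D: "0 < D" unfolding D_def by (rule gcd_diff_supp_pos[OF X1 nd])
  let ?z = "\<lambda>h. chf M (X 1) (of_int h * \<alpha>)"
  let ?a = "\<lambda>h. (norm (fourier_coeff (centered f) h))\<^sup>2"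
  have aK: "?a h \<le> K / (of_int h)\<^sup>2" for h
    by (rule LIMSEQ_le_const2[OF tendsto_weight[OF f q]]) (use K(2)[OF q(2)] in blast)
  have dpos: "0 < int_dist (of_int D * (of_int h * \<alpha>))" if "h \<noteq> 0" for h
    using int_dist_irrational_multiple_pos[OF \<alpha> _ that] D by simp
  have lt: "norm (?z h) < 1" if "?a h \<noteq> 0" for h
  proof -
    have "h \<noteq> 0"
    proof
      assume "h = 0"
      with aK[of 0] that show False by simp
    qed
    then have "norm (?z h) \<noteq> 1"
      using dpos[of h] int_dist_eq_0_iff[of "of_int D * (of_int h * \<alpha>)"]
        chf_unimodular_imp_Ints[OF X1 nd, of "of_int h * \<alpha>"] unfolding D_def by auto
    then show ?thesis using norm_chf_le_1[OF X1, of "of_int h * \<alpha>"] by linarith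
  qed
  have i1: "integrable (count_space UNIV) ?a"
    by (rule Bochner_Integration.integrable_bound[OF integrable_mult_right[OF integrable_inverse_square, of K]])
      (use aK K(1) in auto)
  have i2: "integrable (count_space UNIV) (\<lambda>h. ?a h / norm (1 - ?z h))"
  proof (rule Bochner_Integration.integrable_bound[OF integrable_mult_right[OF dom, of "K / c"]])
    show "AE h in count_space UNIV. norm (?a h / norm (1 - ?z h)) \<le>
      norm (K / c * (1 / ((real_of_int h)\<^sup>2 * int_dist (of_int (gcd_diff_supp M (X 1)) * (of_int h * \<alpha>)))))"
      unfolding D_def[symmetric]
    proof (rule AE_I2)
      fix h
      let ?d = "int_dist (of_int D * (of_int h * \<alpha>))"
      show "norm (?a h / norm (1 - ?z h)) \<le> norm (K / c * (1 / ((real_of_int h)\<^sup>2 * ?d)))"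
      proof (cases "h = 0")
        case True
        with aK[of 0] show ?thesis by simp
      next
        case False
        then have d: "0 < ?d" by (rule dpos)
        have "?a h / norm (1 - ?z h) \<le> (K / (of_int h)\<^sup>2) / (c * ?d)"
          using aK[of h] c(1) d c(2)[of "of_int h * \<alpha>"] K(1) unfolding D_def by (intro frac_le) auto
        also have "\<dots> = K / c * (1 / ((real_of_int h)\<^sup>2 * ?d))" by (simp add: mult_ac)
        finally show ?thesis using d c(1) K(1) by simp
      qed
    qed
  qed auto
  note series = spectral_series[OF corr_circle_eq_integral[OF f q p] i1 zero_le_power2 norm_chf_le_1[OF X1] lt i2]
  from series(1) show "summable (\<lambda>k. corr circle_unif M X \<alpha> (centered f) (Suc k))" .
  have id_circle: "(\<lambda>u. u) \<in> measurable circle_unif borel" by measurable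
  have cm: "centered f \<in> borel_measurable borel"
    using periodic_bv_measurable[OF f] unfolding centered_def[abs_def] by measurable
  show "complex_of_real (C_irr M X \<alpha> f) = (\<integral>h. of_real (?a h) * (1 + 2 * (?z h / (1 - ?z h))) \<partial>count_space UNIV)"
    unfolding C_irr_def corr_series_eq[OF prob_space_circle_unif id_circle cm B]
    by (rule series(2))
qed

text \<open>
  Every frequency is eventually below the threshold, so the terms converge to those at \<open>\<alpha>\<close>. Below it
  \<open>D * \<bar>h\<bar>\<close> is at most \<open>q / 2\<close>, and \<open>best_approx_int_dist\<close> bounds the denominators at \<open>p / q\<close> by those
  at \<open>\<alpha>\<close>, uniformly in \<open>n\<close>.
\<close>

lemma low_frequencies_tendsto:
  assumes f: "f \<in> periodic_bv" and q: "filterlim q at_top sequentially" "\<And>n. 1 \<le> q n"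
    and best: "\<And>n. (p n, q n) \<in> best_approx \<alpha>" and p: "(\<lambda>n. of_int (p n) / real (q n)) \<longlonglongrightarrow> \<alpha>"
    and \<alpha>: "\<alpha> \<notin> \<rat>" and D: "0 < D"
    and c: "0 < c" "\<And>t. c * int_dist (of_int D * t) \<le> norm (1 - chf M (X 1) t)"
    and dom: "integrable (count_space UNIV) (\<lambda>h::int. 1 / ((of_int h)\<^sup>2 * int_dist (of_int D * (of_int h * \<alpha>))))"
  shows "(\<lambda>n. \<integral>h. (if 2 * D * \<bar>h\<bar> \<le> int (q n) then of_real (weight (q n) f h) *
      (1 + 2 * (chf M (X 1) (of_int h * (of_int (p n) / real (q n))) / (1 - chf M (X 1) (of_int h * (of_int (p n) / real (q n)))))) else 0)
      \<partial>count_space UNIV) \<longlonglongrightarrow>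
    (\<integral>h. of_real ((norm (fourier_coeff (centered f) h))\<^sup>2) *
      (1 + 2 * (chf M (X 1) (of_int h * \<alpha>) / (1 - chf M (X 1) (of_int h * \<alpha>)))) \<partial>count_space UNIV)"
proof -
  have X1 [measurable]: "X 1 \<in> measurable M (count_space UNIV)" by (rule measurable_step) simp
  obtain K where K: "0 \<le> K" "\<And>q h. 1 \<le> q \<Longrightarrow> weight q f h \<le> K / (of_int h)\<^sup>2"
    using weight_bound[OF f] by blast
  define z where "z n h = chf M (X 1) (of_int h * (of_int (p n) / real (q n)))" for n h
  define z0 where "z0 h = chf M (X 1) (of_int h * \<alpha>)" for h
  define d where "d h = int_dist (of_int D * (of_int h * \<alpha>))" for h :: int
  have dpos: "0 < d h" if "h \<noteq> 0" for h
    unfolding d_def using int_dist_irrational_multiple_pos[OF \<alpha> _ that] D by simp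
  have z_lim: "(\<lambda>n. z n h) \<longlonglongrightarrow> z0 h" for h
    unfolding z_def z0_def by (intro tendsto_chf[OF X1] tendsto_mult tendsto_const p)
  have low: "d h \<le> 2 * int_dist (of_int D * (of_int h * (of_int (p n) / real (q n))))"
    if "h \<noteq> 0" "2 * D * \<bar>h\<bar> \<le> int (q n)" for n h
  proof -
    have pos: "0 < D * \<bar>h\<bar>" using that(1) D by simp
    define m where "m = nat (D * \<bar>h\<bar>)"
    have m: "int m = D * \<bar>h\<bar>" using pos by (simp add: m_def)
    have "0 < m" "2 * m \<le> q n" using m pos that(2) by linarith+
    from best_approx_int_dist[OF best this]
    have *: "int_dist (real m * \<alpha>) \<le> 2 * int_dist (real m * (of_int (p n) / real (q n)))" .
    have "real m = of_int (int m)" by simp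
    then have rm: "real m = of_int D * \<bar>of_int h\<bar>" unfolding m by simp
    have sgn: "int_dist (real m * t) = int_dist (of_int D * (of_int h * t))" for t
      using int_dist_minus[of "of_int D * (of_int h * t)"] by (cases "0 \<le> h") (simp_all add: rm mult.assoc)
    from * show ?thesis unfolding sgn d_def .
  qed
  have "(\<lambda>n. \<integral>h. (if 2 * D * \<bar>h\<bar> \<le> int (q n) then of_real (weight (q n) f h) * (1 + 2 * (z n h / (1 - z n h))) else 0)
      \<partial>count_space UNIV) \<longlonglongrightarrow>
    (\<integral>h. of_real ((norm (fourier_coeff (centered f) h))\<^sup>2) * (1 + 2 * (z0 h / (1 - z0 h))) \<partial>count_space UNIV)"
  proof (rule integral_dominated_convergence[where w = "\<lambda>h. 4 * K / c * (1 / ((of_int h)\<^sup>2 * d h))"])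
    show "integrable (count_space UNIV) (\<lambda>h::int. 4 * K / c * (1 / ((of_int h)\<^sup>2 * d h)))"
      unfolding d_def by (intro integrable_mult_right dom)
    show "AE h in count_space UNIV. (\<lambda>n. if 2 * D * \<bar>h\<bar> \<le> int (q n)
        then of_real (weight (q n) f h) * (1 + 2 * (z n h / (1 - z n h))) else 0) \<longlonglongrightarrow>
        of_real ((norm (fourier_coeff (centered f) h))\<^sup>2) * (1 + 2 * (z0 h / (1 - z0 h)))"
    proof (rule AE_I2)
      fix h :: int
      have ev: "eventually (\<lambda>n. of_real (weight (q n) f h) * (1 + 2 * (z n h / (1 - z n h))) =
        (if 2 * D * \<bar>h\<bar> \<le> int (q n) then of_real (weight (q n) f h) * (1 + 2 * (z n h / (1 - z n h))) else 0)) sequentially"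
      proof -
        have "eventually (\<lambda>n. nat (2 * D * \<bar>h\<bar>) \<le> q n) sequentially"
          using q(1) by (simp add: filterlim_at_top)
        then show ?thesis by eventually_elim auto
      qed
      have "(\<lambda>n. of_real (weight (q n) f h) * (1 + 2 * (z n h / (1 - z n h)))) \<longlonglongrightarrow>
        of_real ((norm (fourier_coeff (centered f) h))\<^sup>2) * (1 + 2 * (z0 h / (1 - z0 h)))"
      proof (cases "h = 0")
        case True
        have "(\<lambda>n. 0) \<longlonglongrightarrow> (norm (fourier_coeff (centered f) 0))\<^sup>2"
          using tendsto_weight[OF f q, of 0] by (simp add: weight_0)
        then have "(norm (fourier_coeff (centered f) 0))\<^sup>2 = 0" by (simp add: LIMSEQ_const_iff)
        then show ?thesis using True by (simp add: weight_0)
      next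
        case False
        have "0 < c * d h" using c(1) dpos[OF False] by simp
        also have "\<dots> \<le> norm (1 - z0 h)" unfolding d_def z0_def by (rule c(2))
        finally have "1 - z0 h \<noteq> 0" by auto
        then show ?thesis
          by (intro tendsto_mult tendsto_add tendsto_divide tendsto_diff tendsto_const tendsto_of_real
              tendsto_weight[OF f q] z_lim)
      qed
      then show "(\<lambda>n. if 2 * D * \<bar>h\<bar> \<le> int (q n)
        then of_real (weight (q n) f h) * (1 + 2 * (z n h / (1 - z n h))) else 0) \<longlonglongrightarrow>
        of_real ((norm (fourier_coeff (centered f) h))\<^sup>2) * (1 + 2 * (z0 h / (1 - z0 h)))"
        using tendsto_cong[OF ev] by blast
    qed
    show "AE h in count_space UNIV. norm (if 2 * D * \<bar>h\<bar> \<le> int (q n)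
        then of_real (weight (q n) f h) * (1 + 2 * (z n h / (1 - z n h))) else 0) \<le> 4 * K / c * (1 / ((of_int h)\<^sup>2 * d h))" for n
    proof (rule AE_I2)
      fix h :: int
      show "norm (if 2 * D * \<bar>h\<bar> \<le> int (q n)
        then of_real (weight (q n) f h) * (1 + 2 * (z n h / (1 - z n h))) else 0) \<le> 4 * K / c * (1 / ((of_int h)\<^sup>2 * d h))"
      proof (cases "h \<noteq> 0 \<and> 2 * D * \<bar>h\<bar> \<le> int (q n)")
        case True
        have "c * (d h / 2) \<le> c * int_dist (of_int D * (of_int h * (of_int (p n) / real (q n))))"
          using low[of h n] True c(1) by (intro mult_left_mono) auto
        also have "\<dots> \<le> norm (1 - z n h)" unfolding z_def by (rule c(2))
        finally have gap: "c * (d h / 2) \<le> norm (1 - z n h)" .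
        have pos: "0 < c * (d h / 2)" using c(1) dpos True by simp
        have "norm (of_real (weight (q n) f h) * (1 + 2 * (z n h / (1 - z n h))))
            = weight (q n) f h * norm (1 + 2 * (z n h / (1 - z n h)))"
          by (simp only: norm_mult norm_of_real abs_of_nonneg[OF weight_nonneg])
        also have "\<dots> \<le> K / (of_int h)\<^sup>2 * (2 / (c * (d h / 2)))"
        proof (rule mult_mono)
          have "norm (z n h) \<le> 1" unfolding z_def by (rule norm_chf_le_1[OF X1])
          moreover have "z n h \<noteq> 1" using gap pos by auto
          ultimately have "norm (1 + 2 * (z n h / (1 - z n h))) \<le> 2 / norm (1 - z n h)" by (rule norm_cayley_le)
          also have "\<dots> \<le> 2 / (c * (d h / 2))" using gap pos by (intro frac_le) auto
          finally show "norm (1 + 2 * (z n h / (1 - z n h))) \<le> 2 / (c * (d h / 2))" .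
        qed (use K q(2) in auto)
        also have "\<dots> = 4 * K / c * (1 / ((of_int h)\<^sup>2 * d h))" by (simp add: mult_ac)
        finally show ?thesis using True by simp
      next
        case False
        have "0 \<le> 4 * K / c * (1 / ((of_int h)\<^sup>2 * d h))"
          using K(1) c(1) int_dist_nonneg by (simp add: d_def)
        then show ?thesis using False by (cases "h = 0") (auto simp: weight_0)
      qed
    qed
  qed auto
  then show ?thesis unfolding z_def z0_def .
qed

text \<open>
  Above the threshold \<open>1 / h\<^sup>2 \<le> 4 * D\<^sup>2 / q\<^sup>2\<close>, and the reciprocal distances add up to at most
  \<open>2 * q * harm q\<close>.
\<close>

lemma high_frequencies_bound:
  assumes K: "0 \<le> K" "\<And>h. weight q f h \<le> K / (of_int h)\<^sup>2"
    and q: "1 \<le> q" and p: "coprime p (int q)" and D: "0 < D" "coprime D (int q)"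
    and c: "0 < c" "\<And>t. c * int_dist (of_int D * t) \<le> norm (1 - chf M (X 1) t)"
  shows "norm (\<integral>h. (if 2 * D * \<bar>h\<bar> \<le> int q then 0 else of_real (weight q f h) *
      (1 + 2 * (chf M (X 1) (of_int h * (of_int p / real q)) / (1 - chf M (X 1) (of_int h * (of_int p / real q))))))
      \<partial>count_space UNIV) \<le> 16 * K * (of_int D)\<^sup>2 / c * (harm q / real q)"
proof -
  have X1 [measurable]: "X 1 \<in> measurable M (count_space UNIV)" by (rule measurable_step) simp
  define z where "z h = chf M (X 1) (of_int h * (of_int p / real q))" for h
  define F where "F h = (if 2 * D * \<bar>h\<bar> \<le> int q then 0 else of_real (weight q f h) * (1 + 2 * (z h / (1 - z h))))" for h
  define d where "d h = int_dist (of_int (h * (D * p)) / real q)" for h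
  have "F h = (if h \<in> balanced_residues q then F h else 0)" for h by (simp add: F_def weight_def)
  then have "(\<integral>h. F h \<partial>count_space UNIV) = (\<Sum>h\<in>balanced_residues q. F h)"
    unfolding sum_residues_eq_integral by (rule Bochner_Integration.integral_cong[OF refl])
  also have "\<dots> = (\<Sum>h\<in>balanced_residues q - {0}. F h)"
    by (rule sum.mono_neutral_right) (auto simp: F_def weight_0)
  finally have "norm (\<integral>h. F h \<partial>count_space UNIV) \<le> (\<Sum>h\<in>balanced_residues q - {0}. norm (F h))"
    by (simp only: norm_sum)
  also have "\<dots> \<le> (\<Sum>h\<in>balanced_residues q - {0}. 8 * K * (of_int D)\<^sup>2 / (c * (real q)\<^sup>2) * (1 / d h))"
  proof (rule sum_mono)
    fix h assume h: "h \<in> balanced_residues q - {0}"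
    have freq: "of_int D * (of_int h * (of_int p / real q)) = of_int (h * (D * p)) / real q" by simp
    have dpos: "0 < d h"
      using gcd_times_frequency_notin_Ints[OF D(2) p q, of h] h int_dist_nonneg[of "of_int (h * (D * p)) / real q"]
        int_dist_eq_0_iff[of "of_int (h * (D * p)) / real q"]
      unfolding freq d_def by auto
    have gap: "c * d h \<le> norm (1 - z h)" using c(2)[of "of_int h * (of_int p / real q)"] unfolding freq d_def z_def .
    have pos: "0 < c * d h" using c(1) dpos by simp
    show "norm (F h) \<le> 8 * K * (of_int D)\<^sup>2 / (c * (real q)\<^sup>2) * (1 / d h)"
    proof (cases "2 * D * \<bar>h\<bar> \<le> int q")
      case True
      then show ?thesis using K(1) c(1) dpos by (simp add: F_def)
    next
      case False
      have "norm (F h) = weight q f h * norm (1 + 2 * (z h / (1 - z h)))"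
        using False by (simp only: F_def if_False norm_mult norm_of_real abs_of_nonneg[OF weight_nonneg])
      also have "\<dots> \<le> 4 * K * (of_int D)\<^sup>2 / (real q)\<^sup>2 * (2 / (c * d h))"
      proof (rule mult_mono)
        have "real_of_int (int q) \<le> of_int (2 * D * \<bar>h\<bar>)" using False by (simp only: of_int_le_iff)
        then have "(real q)\<^sup>2 \<le> (2 * of_int D * \<bar>of_int h\<bar>)\<^sup>2" by (intro power_mono) auto
        then have sq: "(real q)\<^sup>2 \<le> 4 * (of_int D)\<^sup>2 * (of_int h)\<^sup>2" by (simp add: power_mult_distrib)
        have "weight q f h \<le> K / (of_int h)\<^sup>2" by (rule K(2))
        also have "\<dots> = 4 * K * (of_int D)\<^sup>2 / (4 * (of_int D)\<^sup>2 * (of_int h)\<^sup>2)" using D(1) by simp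
        also have "\<dots> \<le> 4 * K * (of_int D)\<^sup>2 / (real q)\<^sup>2"
          using sq K(1) q by (intro divide_left_mono) (auto intro!: mult_pos_pos simp: less_le_trans)
        finally show "weight q f h \<le> 4 * K * (of_int D)\<^sup>2 / (real q)\<^sup>2" .
        have "norm (z h) \<le> 1" unfolding z_def by (rule norm_chf_le_1[OF X1])
        moreover have "z h \<noteq> 1" using gap pos by auto
        ultimately have "norm (1 + 2 * (z h / (1 - z h))) \<le> 2 / norm (1 - z h)" by (rule norm_cayley_le)
        also have "\<dots> \<le> 2 / (c * d h)" using gap pos by (intro frac_le) auto
        finally show "norm (1 + 2 * (z h / (1 - z h))) \<le> 2 / (c * d h)" .
      qed (use K(1) in auto)
      also have "\<dots> = 8 * K * (of_int D)\<^sup>2 / (c * (real q)\<^sup>2) * (1 / d h)" by (simp add: mult_ac)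
      finally show ?thesis .
    qed
  qed
  also have "\<dots> = 8 * K * (of_int D)\<^sup>2 / (c * (real q)\<^sup>2) * (\<Sum>h\<in>balanced_residues q - {0}. 1 / d h)"
    by (simp only: sum_distrib_left)
  also have "\<dots> \<le> 8 * K * (of_int D)\<^sup>2 / (c * (real q)\<^sup>2) * (2 * real q * harm q)"
  proof (rule mult_left_mono)
    have "coprime (D * p) (int q)" using D(2) p by simp
    then show "(\<Sum>h\<in>balanced_residues q - {0}. 1 / d h) \<le> 2 * real q * harm q"
      unfolding d_def by (rule sum_inverse_int_dist_residues[OF q])
  qed (use K(1) c(1) in auto)
  also have "\<dots> = 16 * K * (of_int D)\<^sup>2 / c * (harm q / real q)"
    using q c(1) by (simp add: power2_eq_square)
  finally show ?thesis unfolding F_def z_def .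
qed

text \<open>
  The series at \<open>p / q\<close> is split at \<open>2 * D * \<bar>h\<bar> = q\<close>; the low part has the right limit, and the high part
  tends to \<open>0\<close> along the denominators coprime to \<open>D\<close>, which are all but finitely many.
\<close>

theorem C_rat_tendsto_C_irr:
  assumes nd: "\<not> (\<exists>c. AE w in M. X 1 w = c)"
    and int: "integrable M (\<lambda>w. real_of_int (X 1 w))" and mean: "(\<integral>w. real_of_int (X 1 w) \<partial>M) \<noteq> 0"
    and \<alpha>: "\<alpha> \<notin> \<rat>" and \<gamma>: "0 < \<gamma>" "\<gamma> < 2"
    and low: "0 < c0" "\<And>h::int. h \<noteq> 0 \<Longrightarrow> c0 \<le> \<bar>of_int h\<bar> powr \<gamma> * int_dist (of_int h * \<alpha>)"
    and f: "f \<in> periodic_bv"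
    and best: "strict_mono q" "\<And>n. (p n, q n) \<in> best_approx \<alpha>"
    and cop: "eventually (\<lambda>n. coprime (gcd_diff_supp M (X 1)) (int (q n))) sequentially"
  shows "summable (\<lambda>k. corr circle_unif M X \<alpha> (centered f) (Suc k))"
    and "coprime (gcd_diff_supp M (X 1)) (int (q n)) \<Longrightarrow>
       summable (\<lambda>k. corr (cyclic_unif (q n)) M X (real_of_int (p n) / real (q n)) (centered_cyclic (q n) f) (Suc k))"
    and "(\<lambda>n. C_rat M X (p n) (q n) f) \<longlonglongrightarrow> C_irr M X \<alpha> f"
proof -
  have X1 [measurable]: "X 1 \<in> measurable M (count_space UNIV)" by (rule measurable_step) simp
  define D where "D = gcd_diff_supp M (X 1)"
  have D: "0 < D" unfolding D_def by (rule gcd_diff_supp_pos[OF X1 nd])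
  obtain c where c: "0 < c" "\<And>t. c * int_dist (of_int D * t) \<le> norm (1 - chf M (X 1) t)"
    using chf_lower_bound[OF X1 nd int mean] unfolding D_def by blast
  obtain K where K: "0 \<le> K" "\<And>q h. 1 \<le> q \<Longrightarrow> weight q f h \<le> K / (of_int h)\<^sup>2"
    using weight_bound[OF f] by blast
  have q1: "1 \<le> q n" and pq: "coprime (p n) (int (q n))" for n
    using best(2)[of n] by (auto simp: best_approx_def)
  have q: "filterlim q at_top sequentially" using best(1) by (rule filterlim_subseq)
  have p: "(\<lambda>n. of_int (p n) / real (q n)) \<longlonglongrightarrow> \<alpha>"
  proof (rule LIM_zero_cancel, rule Lim_null_comparison)
    show "(\<lambda>n. 1 / real (q n)) \<longlonglongrightarrow> 0" using filterlim_compose[OF lim_1_over_n q] by simp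
    show "\<forall>\<^sub>F n in sequentially. norm (of_int (p n) / real (q n) - \<alpha>) \<le> 1 / real (q n)"
      using best_approx_error[OF best(2)] by simp
  qed
  have dom: "integrable (count_space UNIV) (\<lambda>h::int. 1 / ((of_int h)\<^sup>2 * int_dist (of_int D * (of_int h * \<alpha>))))"
    by (rule integrable_inverse_square_int_dist[OF low(1) \<gamma> D low(2)])
  note circle = circle_series[OF f q q1 p nd \<alpha> c(1) c(2)[unfolded D_def] dom[unfolded D_def]]
  show "summable (\<lambda>k. corr circle_unif M X \<alpha> (centered f) (Suc k))" by (rule circle(1))
  note cyclic = cyclic_series[OF f q1 pq nd]
  show "summable (\<lambda>k. corr (cyclic_unif (q n)) M X (real_of_int (p n) / real (q n)) (centered_cyclic (q n) f) (Suc k))"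
    if "coprime (gcd_diff_supp M (X 1)) (int (q n))"
    by (rule cyclic(1)[OF that])
  define G where "G n h = of_real (weight (q n) f h) * (1 + 2 * (chf M (X 1) (of_int h * (of_int (p n) / real (q n))) /
    (1 - chf M (X 1) (of_int h * (of_int (p n) / real (q n))))))" for n h
  define lo where "lo n = (\<integral>h. (if 2 * D * \<bar>h\<bar> \<le> int (q n) then G n h else 0) \<partial>count_space UNIV)" for n
  define hi where "hi n = (\<integral>h. (if 2 * D * \<bar>h\<bar> \<le> int (q n) then 0 else G n h) \<partial>count_space UNIV)" for n
  have split: "(\<integral>h. G n h \<partial>count_space UNIV) = lo n + hi n" for n
  proof -
    have "integrable (count_space UNIV) (\<lambda>h. if 2 * D * \<bar>h\<bar> \<le> int (q n) then G n h else 0)"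
      "integrable (count_space UNIV) (\<lambda>h. if 2 * D * \<bar>h\<bar> \<le> int (q n) then 0 else G n h)"
      by (rule integrable_count_space_finite_support, rule finite_subset[OF _ weight_finite_support[of "q n" f]], auto simp: G_def)+
    then have "lo n + hi n = (\<integral>h. (if 2 * D * \<bar>h\<bar> \<le> int (q n) then G n h else 0) +
        (if 2 * D * \<bar>h\<bar> \<le> int (q n) then 0 else G n h) \<partial>count_space UNIV)"
      unfolding lo_def hi_def by (rule Bochner_Integration.integral_add[symmetric])
    also have "\<dots> = (\<integral>h. G n h \<partial>count_space UNIV)" by (rule Bochner_Integration.integral_cong) auto
    finally show ?thesis ..
  qed
  have lo: "lo \<longlonglongrightarrow> complex_of_real (C_irr M X \<alpha> f)"
    using low_frequencies_tendsto[OF f q q1 best(2) p \<alpha> D c dom]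
    unfolding circle(2) lo_def G_def .
  have hi: "hi \<longlonglongrightarrow> 0"
  proof (rule Lim_null_comparison)
    have "(\<lambda>n. harm (q n) / real (q n)) \<longlonglongrightarrow> 0" using filterlim_compose[OF harm_over_n q] by simp
    then show "(\<lambda>n. 16 * K * (of_int D)\<^sup>2 / c * (harm (q n) / real (q n))) \<longlonglongrightarrow> 0"
      by (rule tendsto_mult_right_zero)
    show "\<forall>\<^sub>F n in sequentially. norm (hi n) \<le> 16 * K * (of_int D)\<^sup>2 / c * (harm (q n) / real (q n))"
      using cop
    proof eventually_elim
      case (elim n)
      show ?case unfolding hi_def G_def
        by (rule high_frequencies_bound[OF K(1) K(2)[OF q1] q1 pq D elim[folded D_def] c])
    qed
  qed
  have "(\<lambda>n. lo n + hi n) \<longlonglongrightarrow> complex_of_real (C_irr M X \<alpha> f)"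
    using tendsto_add[OF lo hi] by simp
  moreover have "eventually (\<lambda>n. lo n + hi n = complex_of_real (C_rat M X (p n) (q n) f)) sequentially"
    using cop
  proof eventually_elim
    case (elim n)
    show ?case unfolding split[symmetric] cyclic(2)[OF elim] G_def ..
  qed
  ultimately have "(\<lambda>n. complex_of_real (C_rat M X (p n) (q n) f)) \<longlonglongrightarrow> complex_of_real (C_irr M X \<alpha> f)"
    by (simp add: tendsto_cong)
  then show "(\<lambda>n. C_rat M X (p n) (q n) f) \<longlonglongrightarrow> C_irr M X \<alpha> f" by (simp add: tendsto_of_real_iff)
qed

end

theorem proposition4:
  fixes M :: "'w measure" and X :: "nat \<Rightarrow> 'w \<Rightarrow> int"
    and \<alpha> \<gamma> :: real and f :: "real \<Rightarrow> real"
    and p :: "nat \<Rightarrow> int" and q :: "nat \<Rightarrow> nat"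
  assumes "prob_space M"
    and "prob_space.indep_vars M (\<lambda>_. count_space UNIV) X {1..}"
    and "\<And>j. j \<ge> 1 \<Longrightarrow> distr M (count_space UNIV) (X j) = distr M (count_space UNIV) (X 1)"
    and "\<not> (\<exists>c. AE w in M. X 1 w = c)"
    and "integrable M (\<lambda>w. real_of_int (X 1 w))"
    and "(\<integral>w. real_of_int (X 1 w) \<partial>M) \<noteq> 0"
    and "\<alpha> \<notin> \<rat>"
    and "1 \<le> \<gamma>" and "\<gamma> < 2"
    and "(INF h \<in> UNIV - {0::int}. \<bar>real_of_int h\<bar> powr \<gamma> * int_dist (real_of_int h * \<alpha>)) > 0"
    and "f \<in> periodic_bv"
    and "best_approx_seq \<alpha> p q"
    and "finite {n. \<not> coprime (gcd_diff_supp M (X 1)) (int (q n))}"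
  shows "summable (\<lambda>k. corr circle_unif M X \<alpha> (centered f) (Suc k)) \<and>
    (\<forall>n. coprime (gcd_diff_supp M (X 1)) (int (q n)) \<longrightarrow>
       summable (\<lambda>k. corr (cyclic_unif (q n)) M X (real_of_int (p n) / real (q n))
         (centered_cyclic (q n) f) (Suc k))) \<and>
    (\<lambda>n. C_rat M X (p n) (q n) f) \<longlonglongrightarrow> C_irr M X \<alpha> f"
proof -
  interpret iid_walk M X
    by (intro iid_walk.intro iid_walk_axioms.intro assms(1-3))
  define c0 where "c0 = (INF h \<in> UNIV - {0::int}. \<bar>real_of_int h\<bar> powr \<gamma> * int_dist (real_of_int h * \<alpha>))"
  have c0: "c0 \<le> \<bar>of_int h\<bar> powr \<gamma> * int_dist (of_int h * \<alpha>)" if "h \<noteq> 0" for h :: int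
    unfolding c0_def
    by (rule cINF_lower) (use that in \<open>auto intro!: bdd_belowI2[where m = 0] simp: int_dist_nonneg\<close>)
  have \<gamma>: "0 < \<gamma>" using assms(8) by simp
  have best: "strict_mono q" "(p n, q n) \<in> best_approx \<alpha>" for n
    using assms(12) by (auto simp: best_approx_seq_def)
  have cop: "eventually (\<lambda>n. coprime (gcd_diff_supp M (X 1)) (int (q n))) sequentially"
    using assms(13) by (simp add: eventually_cofinite[symmetric] cofinite_eq_sequentially)
  show ?thesis
    using C_rat_tendsto_C_irr[OF assms(4-7) \<gamma> assms(9) assms(10)[folded c0_def] c0 assms(11) best cop]
    by blast
qed

end
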